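(* Let $\mathbb F\in\{\mathbb R,\mathbb C\}$, let $K,N,R,F$ be positive integers and $d_1,\dots,d_F$ nonnegative integers. Assume that the mixing matrix $\mathbf M\in\mathbb F^{K\times R}$ has full column rank and that $$R\leq N-(d_1+\dots+d_F+2F).$$ Then $\mathbf M$ and $R$ generic sources of the form $$s(n)=\sum_{f=1}^F\left(p_{0f}+p_{1f}n+\dots+p_{d_ff}n^{d_f}\right)a_f^n,\qquad n=1,\dots,N,$$ can be uniquely recovered from the observed data $\mathbf X=\mathbf M\mathbf S^T$, where $\mathbf S\in\mathbb F^{N\times R}$ is the matrix whose $r$th column is $[s_r(1)\ \dots\ s_r(N)]^T$, $s_r$ being the $r$th source.
   Context: A $K\times R$ matrix has full column rank if its rank is $R$. Each source is determined by its parameter vector $\boldsymbol\zeta=[a_1\ p_{01}\ \dots\ p_{d_11}\ \dots\ a_F\ p_{0F}\ \dots\ p_{d_FF}]^T\in\mathbb F^l$ with $l=d_1+\dots+d_F+2F$. "$R$ generic sources" means that the assertion holds for all parameter vectors $(\boldsymbol\zeta_1,\dots,\boldsymbol\zeta_R)\in\mathbb F^{Rl}$ outside a set of Lebesgue measure zero, where $\boldsymbol\zeta_r$ is the parameter vector of the $r$th source. "Uniquely recovered" means that the decomposition $\mathbf X=\sum_{r=1}^R\mathbf m_r\mathbf s_r^T$ ($\mathbf m_r$, $\mathbf s_r$ the $r$th columns of $\mathbf M$, $\mathbf S$) is unique up to permutation of its rank-1 terms: whenever $\mathbf X=\overline{\mathbf M}\,\overline{\mathbf S}^T$ with $\overline{\mathbf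 M}\in\mathbb F^{K\times R}$ and $\overline{\mathbf S}\in\mathbb F^{N\times R}$ such that every column of $\overline{\mathbf S}$ is a vector $[s(1)\ \dots\ s(N)]^T$ with $s(n)=\sum_{f=1}^F\left(p_{0f}+p_{1f}n+\dots+p_{d_ff}n^{d_f}\right)a_f^n$ for $n=1,\dots,N$ (same $F,d_1,\dots,d_F$, arbitrary parameters in $\mathbb F$), there is a permutation $\sigma$ of $\{1,\dots,R\}$ with $\overline{\mathbf m}_r\overline{\mathbf s}_r^T=\mathbf m_{\sigma(r)}\mathbf s_{\sigma(r)}^T$ for all $r$. *)

theory Defs
  imports
    "HOL-Analysis.Analysis"
    "HOL-Combinatorics.Permutations"
    "Jordan_Normal_Form.DL_Rank"
begin

unbundle no vec_syntax
unbundle no inner_syntax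

text \<open>Indices are shifted to start at 0: the matrix row \<open>i\<close> is the sampling point \<open>i + 1\<close>,
  and \<open>f < F\<close>, \<open>r < R\<close> number the exponentials and the sources.
  \<open>Pole f\<close> is the coordinate holding \<open>a\<^sub>f\<close>, \<open>Coeff j f\<close> the one holding \<open>p\<^sub>j\<^sub>f\<close>.\<close>

datatype coord = Pole nat | Coeff nat nat

definition coords :: "nat \<Rightarrow> (nat \<Rightarrow> nat) \<Rightarrow> coord set" where
  "coords F d = {Pole f |f. f < F} \<union> {Coeff j f |j f. f < F \<and> j \<le> d f}"

lemma coords_alt: "coords F d = Pole ` {..<F} \<union> (\<lambda>(f, j). Coeff j f) ` (SIGMA f:{..<F}. {..d f})"
  by (auto simp: coords_def)

lemma finite_coords: "finite (coords F d)"
  unfolding coords_alt by auto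

lemma card_coords: "card (coords F d) = (\<Sum>f<F. d f) + 2 * F"
proof -
  have "card (coords F d) = card (Pole ` {..<F})
      + card ((\<lambda>(f, j). Coeff j f) ` (SIGMA f:{..<F}. {..d f}))"
    unfolding coords_alt by (rule card_Un_disjoint) auto
  also have "card (Pole ` {..<F}) = F"
    by (subst card_image) (auto simp: inj_on_def)
  also have "card ((\<lambda>(f, j). Coeff j f) ` (SIGMA f:{..<F}. {..d f})) = (\<Sum>f<F. Suc (d f))"
    by (subst card_image) (auto simp: inj_on_def)
  finally show ?thesis
    by (simp add: sum_Suc)
qed

definition source :: "nat \<Rightarrow> (nat \<Rightarrow> nat) \<Rightarrow> (coord \<Rightarrow> 'a::comm_semiring_1) \<Rightarrow> nat \<Rightarrow> 'a" where
  "source F d z n = (\<Sum>f<F. (\<Sum>j\<le>d f. z (Coeff j f) * of_nat n ^ j) * z (Pole f) ^ n)"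

definition source_vec ::
    "nat \<Rightarrow> nat \<Rightarrow> (nat \<Rightarrow> nat) \<Rightarrow> (coord \<Rightarrow> 'a::comm_semiring_1) \<Rightarrow> 'a Matrix.vec" where
  "source_vec N F d z = Matrix.vec N (\<lambda>i. source F d z (i + 1))"

definition source_mat ::
    "nat \<Rightarrow> nat \<Rightarrow> nat \<Rightarrow> (nat \<Rightarrow> nat) \<Rightarrow> (nat \<times> coord \<Rightarrow> 'a::comm_semiring_1) \<Rightarrow> 'a Matrix.mat" where
  "source_mat N R F d \<zeta> =
     mat_of_cols N (map (\<lambda>r. source_vec N F d (\<lambda>c. \<zeta> (r, c))) [0..<R])"

text \<open>Lebesgue measure on the joint parameter space of \<open>R\<close> sources; on the complex type
  \<^const>\<open>lborel\<close> is two-dimensional Lebesgue measure.\<close>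

definition param_measure ::
    "nat \<Rightarrow> nat \<Rightarrow> (nat \<Rightarrow> nat) \<Rightarrow> (nat \<times> coord \<Rightarrow> 'a::euclidean_space) measure" where
  "param_measure R F d = Pi\<^sub>M ({..<R} \<times> coords F d) (\<lambda>_. lborel)"

definition outer_prod :: "'a::times Matrix.vec \<Rightarrow> 'a Matrix.vec \<Rightarrow> 'a Matrix.mat" where
  "outer_prod u v = Matrix.mat (dim_vec u) (dim_vec v) (\<lambda>(i, j). vec_index u i * vec_index v j)"

definition uniquely_recovered ::
    "nat \<Rightarrow> nat \<Rightarrow> nat \<Rightarrow> nat \<Rightarrow> (nat \<Rightarrow> nat) \<Rightarrow> 'a::comm_ring_1 Matrix.mat \<Rightarrow> 'a Matrix.mat \<Rightarrow> bool"
  where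
  "uniquely_recovered K N R F d M S \<longleftrightarrow>
     (\<forall>M' \<in> carrier_mat K R. \<forall>S' \<in> carrier_mat N R.
        (\<forall>r<R. \<exists>z. col S' r = source_vec N F d z) \<longrightarrow>
        M * transpose_mat S = M' * transpose_mat S' \<longrightarrow>
        (\<exists>\<sigma>. \<sigma> permutes {..<R} \<and>
          (\<forall>r<R. outer_prod (col M' r) (col S' r) = outer_prod (col M (\<sigma> r)) (col S (\<sigma> r)))))"

end

theory Submission
  imports Defs "HOL-Computational_Algebra.Polynomial"
begin

text \<open>
  Each source is linear in its coefficients once its \<open>F\<close> poles are fixed, so a relation
  \<open>\<Sum>r\<in>P. c r * s\<^sub>r = s\<close> with all \<open>c r \<noteq> 0\<close> between the given sources and a further source \<open>s\<close> is a
  linear relation between the sampled modes \<open>n^j * x^n\<close> at the poles \<open>x\<close> of \<open>s\<^sub>r\<close>, \<open>r \<in> P\<close>, and of \<open>s\<close>.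

  If these modes span the whole space, \<open>N\<close> of the coefficients are Lipschitz functions of the
  remaining parameters. Counting these, the poles and the scalars \<open>c r\<close> shows that the
  configurations of \<open>R\<close> sources satisfying such a relation lie in a Lipschitz image of a space of
  dimension at most \<open>R * l - 1\<close>, where \<open>l = card (coords F d)\<close>: a null set, as one sees by covering
  it with small boxes.

  If the modes do not span, a nonzero polynomial of degree at most \<open>N\<close> vanishes at all the poles
  with the right multiplicities. Lowering its multiplicity at a pole \<open>x\<close> of \<open>s\<^sub>r\<close> that is not shared
  with any other source to one less than required extracts from the relation the top coefficient of
  \<open>s\<^sub>r\<close> at \<open>x\<close>, which is not zero. So all \<open>F\<close> poles of each \<open>s\<^sub>r\<close> with \<open>r \<in> P\<close> are poles of \<open>s\<close>, and as
  generic poles are distinct, \<open>P\<close> has at most one element. Hence a column of another factorization,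
  being a combination of the given sources, is a multiple of one of them.
\<close>

section \<open>Lipschitz images of lower dimension are null sets\<close>

text \<open>A grid of mesh \<open>1/k\<close> cuts the parameters into
  \<open>O(k^(D * card J))\<close> cells, where \<open>D\<close> is the real dimension of the field,
  and each cell is sent by \<phi> into a box of volume \<open>O(k^-(D * card I))\<close>. The total
  volume is \<open>O(1/k)\<close>. Intersecting these finite unions of boxes over all
  \<open>k\<close> gives a measurable null set, whatever the image of \<phi> looks like.\<close>

lemma AE_PiM_lower_dim:
  fixes \<phi> :: "'p \<Rightarrow> 'i \<Rightarrow> 'a::euclidean_space" and \<pi> :: "'p \<Rightarrow> 'j \<Rightarrow> 'a"
  assumes fin: "finite I" "finite J" and less: "card J < card I"
    and bd: "\<And>p j. p \<in> E \<Longrightarrow> j \<in> J \<Longrightarrow> norm (\<pi> p j) \<le> B"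
    and lip: "\<And>p q i. p \<in> E \<Longrightarrow> q \<in> E \<Longrightarrow> i \<in> I \<Longrightarrow>
      norm (\<phi> p i - \<phi> q i) \<le> L * (\<Sum>j\<in>J. norm (\<pi> p j - \<pi> q j))"
  shows "AE x in Pi\<^sub>M I (\<lambda>_. lborel). \<forall>p\<in>E. \<exists>i\<in>I. x i \<noteq> \<phi> p i"
proof -
  interpret product_sigma_finite "\<lambda>_::'i. lborel :: 'a measure"
    by standard
  let ?M = "Pi\<^sub>M I (\<lambda>_. lborel :: 'a measure)"
  define D where "D = DIM('a)"
  have D: "D > 0" by (simp add: D_def)
  obtain b0 where b0: "B \<le> real b0" using real_arch_simple by blast
  \<comment> \<open>The successor ensures \<open>b \<ge> 1\<close>, which absorbs the
    \<open>+ 1\<close> of the cell count into \<open>3 * b * k\<close>.\<close>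
  define b where "b = Suc b0"
  have b: "B \<le> real b" "b \<ge> 1" using b0 by (auto simp: b_def)
  \<comment> \<open>Points of one cell differ in each of the \<open>card J\<close> coordinates by at
    most \<open>D / k\<close> in norm, so \<open>A / k\<close> bounds the distance of their
    images.\<close>
  define A where "A = \<bar>L\<bar> * (real (card J) * real D)"
  have A0: "A \<ge> 0" by (simp add: A_def)
  define cell where "cell k p = (\<lambda>j\<in>J. \<lambda>e\<in>(Basis::'a set). \<lfloor>real k * inner (\<pi> p j) e\<rfloor>)" for k :: nat and p
  define rep where "rep k = inv_into E (cell k)" for k
  define box where "box k c = (\<Pi>\<^sub>E i\<in>I. cbox (\<phi> (rep k c) i - (A / real k) *\<^sub>R One)
      (\<phi> (rep k c) i + (A / real k) *\<^sub>R One))" for k c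
  define cells where "cells k = (PiE J (\<lambda>_. PiE (Basis::'a set) (\<lambda>_. {- int (k * b)..int (k * b)})))" for k :: nat
  have card_cells: "finite (cells k)" "card (cells k) = (2 * k * b + 1) ^ (D * card J)" for k
    using fin by (auto simp: cells_def card_PiE finite_PiE D_def power_mult nat_add_distrib nat_mult_distrib
        intro!: arg_cong[where f="\<lambda>x. (x ^ _) ^ _"])
  have cell_in: "cell k p \<in> cells k" if "p \<in> E" for k p
  proof -
    have "\<lfloor>real k * inner (\<pi> p j) e\<rfloor> \<in> {- int (k * b)..int (k * b)}" if "j \<in> J" "e \<in> Basis" for j e
    proof -
      have "\<bar>inner (\<pi> p j) e\<bar> \<le> real b"
        using Basis_le_norm[OF \<open>e \<in> Basis\<close>, of "\<pi> p j"] bd[OF \<open>p \<in> E\<close> \<open>j \<in> J\<close>] b by linarith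
      then have "real k * \<bar>inner (\<pi> p j) e\<bar> \<le> real k * real b"
        by (intro mult_left_mono) auto
      then have "\<bar>real k * inner (\<pi> p j) e\<bar> \<le> real (k * b)"
        by (simp add: abs_mult)
      then have "real k * inner (\<pi> p j) e \<le> of_int (int (k * b))" "of_int (- int (k * b)) \<le> real k * inner (\<pi> p j) e"
        by (auto simp: abs_le_iff)
      then show ?thesis unfolding atLeastAtMost_iff by linarith
    qed
    then show ?thesis unfolding cells_def cell_def by (auto simp: PiE_iff)
  qed
  define C where "C k = (\<Union>c \<in> cell k ` E. box k c)" for k
  have fin_im: "finite (cell k ` E)" for k
    using cell_in by (auto intro: finite_subset[OF _ card_cells(1)])
  have box_sets: "box k c \<in> sets ?M" for k c
    unfolding box_def by (intro sets_PiM_I_finite fin) auto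
  have C_sets: "C k \<in> sets ?M" for k
    unfolding C_def by (intro sets.finite_UN fin_im box_sets)
  have box_em: "emeasure ?M (box k c) = ennreal ((2 * A / real k) ^ (D * card I))" for k c
  proof -
    have "emeasure (lborel :: 'a measure) (cbox (x - (A / real k) *\<^sub>R One) (x + (A / real k) *\<^sub>R One))
        = ennreal ((2 * A / real k) ^ D)" for x :: 'a
      by (subst emeasure_lborel_cbox) (use A0 in \<open>auto simp: inner_simps D_def intro!: arg_cong[where f="\<lambda>x. x ^ _"]\<close>)
    then show ?thesis unfolding box_def
      by (subst emeasure_PiM) (use A0 fin in \<open>auto simp: ennreal_power power_mult\<close>)
  qed
  define Z where "Z = (3 * real b) ^ (D * card J) * (2 * A) ^ (D * card I)"
  have C_em: "emeasure ?M (C k) \<le> ennreal (Z / real k)" if k: "k > 0" for k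
  proof -
    have "emeasure ?M (C k) \<le> (\<Sum>c \<in> cell k ` E. emeasure ?M (box k c))"
      unfolding C_def by (intro emeasure_subadditive_finite fin_im) (use box_sets in auto)
    also have "\<dots> = ennreal (real (card (cell k ` E)) * (2 * A / real k) ^ (D * card I))"
      using A0 by (simp add: box_em ennreal_mult ennreal_of_nat_eq_real_of_nat)
    also have "\<dots> \<le> ennreal (Z / real k)"
    proof (intro ennreal_leI)
      have "card (cell k ` E) \<le> (2 * k * b + 1) ^ (D * card J)"
        using card_mono[OF card_cells(1), of "cell k ` E" k] cell_in card_cells(2)[of k] by auto
      also have "\<dots> \<le> (3 * b * k) ^ (D * card J)"
      proof (rule power_mono)
        have "1 \<le> k * b" using k b by (simp add: Suc_le_eq)
        then show "2 * k * b + 1 \<le> 3 * b * k" by (simp add: algebra_simps)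
      qed auto
      finally have "real (card (cell k ` E)) \<le> real ((3 * b * k) ^ (D * card J))"
        by (simp only: of_nat_le_iff)
      also have "\<dots> = (3 * real b) ^ (D * card J) * real k ^ (D * card J)"
        by (simp add: power_mult_distrib)
      finally have 1: "real (card (cell k ` E)) \<le> (3 * real b) ^ (D * card J) * real k ^ (D * card J)" .
      \<comment> \<open>The missing dimension leaves at least one factor
        \<open>1 / k\<close>.\<close>
      have "D * card J + 1 \<le> D * card I"
      proof -
        have "D * (card J + 1) \<le> D * card I" using less by (intro mult_le_mono) auto
        then show ?thesis using D by simp
      qed
      then have "real k ^ (D * card J + 1) \<le> real k ^ (D * card I)"
        using k by (intro power_increasing) auto
      then have 2: "real k ^ (D * card J) / real k ^ (D * card I) \<le> 1 / real k"
        using k by (simp add: field_simps)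
      have "real (card (cell k ` E)) * (2 * A / real k) ^ (D * card I)
          \<le> ((3 * real b) ^ (D * card J) * real k ^ (D * card J)) * (2 * A / real k) ^ (D * card I)"
        using A0 by (intro mult_right_mono 1) auto
      also have "\<dots> = Z * (real k ^ (D * card J) / real k ^ (D * card I))"
        by (simp add: Z_def power_divide)
      also have "\<dots> \<le> Z * (1 / real k)"
        using A0 by (intro mult_left_mono 2) (auto simp: Z_def)
      finally show "real (card (cell k ` E)) * (2 * A / real k) ^ (D * card I) \<le> Z / real k" by simp
    qed
    finally show ?thesis .
  qed
  have cover: "x \<in> C k" if x: "x \<in> space ?M" and p: "p \<in> E" "\<And>i. i \<in> I \<Longrightarrow> x i = \<phi> p i" and k: "k > 0" for x p k
  proof -
    define q where "q = rep k (cell k p)"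
    have q: "q \<in> E" "cell k q = cell k p"
      unfolding q_def rep_def using p(1) by (auto intro: inv_into_into f_inv_into_f)
    have close: "norm (\<pi> p j - \<pi> q j) \<le> real D / real k" if "j \<in> J" for j
    proof -
      have "\<bar>inner (\<pi> p j - \<pi> q j) e\<bar> \<le> 1 / real k" if e: "e \<in> Basis" for e
      proof -
        have "\<lfloor>real k * inner (\<pi> q j) e\<rfloor> = \<lfloor>real k * inner (\<pi> p j) e\<rfloor>"
          using fun_cong[OF fun_cong[OF q(2), of j], of e] \<open>j \<in> J\<close> e by (simp add: cell_def)
        then have "\<bar>real k * inner (\<pi> p j) e - real k * inner (\<pi> q j) e\<bar> \<le> 1" by linarith
        then have "real k * \<bar>inner (\<pi> p j - \<pi> q j) e\<bar> \<le> 1"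
          using k by (simp add: inner_simps abs_mult flip: right_diff_distrib)
        then show ?thesis using k by (simp add: field_simps)
      qed
      then have "(\<Sum>e\<in>Basis. \<bar>inner (\<pi> p j - \<pi> q j) e\<bar>) \<le> real D * (1 / real k)"
        unfolding D_def by (intro sum_bounded_above) auto
      then show ?thesis using norm_le_l1[of "\<pi> p j - \<pi> q j"] by simp
    qed
    have dist: "norm (x i - \<phi> q i) \<le> A / real k" if i: "i \<in> I" for i
    proof -
      have "norm (x i - \<phi> q i) \<le> L * (\<Sum>j\<in>J. norm (\<pi> p j - \<pi> q j))"
        using lip[OF p(1) q(1) i] p(2)[OF i] by simp
      also have "\<dots> \<le> \<bar>L\<bar> * (\<Sum>j\<in>J. norm (\<pi> p j - \<pi> q j))"
        by (intro mult_right_mono sum_nonneg) auto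
      also have "\<dots> \<le> \<bar>L\<bar> * (real (card J) * (real D / real k))"
        by (intro mult_left_mono sum_bounded_above close) auto
      finally show ?thesis by (simp add: A_def)
    qed
    have "x i \<in> cbox (\<phi> q i - (A / real k) *\<^sub>R One) (\<phi> q i + (A / real k) *\<^sub>R One)" if i: "i \<in> I" for i
      unfolding mem_box
    proof (intro ballI)
      fix e :: 'a assume e: "e \<in> Basis"
      have "\<bar>inner (x i - \<phi> q i) e\<bar> \<le> A / real k"
        using Basis_le_norm[OF e, of "x i - \<phi> q i"] dist[OF i] by linarith
      then show "inner (\<phi> q i - (A / real k) *\<^sub>R One) e \<le> inner (x i) e
          \<and> inner (x i) e \<le> inner (\<phi> q i + (A / real k) *\<^sub>R One) e"
        using e by (auto simp: inner_simps abs_le_iff)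
    qed
    then have "x \<in> box k (cell k p)"
      using x by (auto simp: box_def q_def space_PiM PiE_iff)
    then show ?thesis using p(1) by (auto simp: C_def)
  qed
  define Nl where "Nl = (\<Inter>k. C (Suc k))"
  have "Nl \<in> null_sets ?M"
  proof
    show "Nl \<in> sets ?M" unfolding Nl_def by (intro sets.countable_INT) (use C_sets in auto)
    have "emeasure ?M Nl \<le> ennreal (Z / real (Suc k))" for k
    proof -
      have "emeasure ?M Nl \<le> emeasure ?M (C (Suc k))"
        by (intro emeasure_mono C_sets) (auto simp: Nl_def)
      also have "\<dots> \<le> ennreal (Z / real (Suc k))" by (intro C_em) auto
      finally show ?thesis .
    qed
    moreover have "(\<lambda>k. ennreal (Z / real (Suc k))) \<longlonglongrightarrow> ennreal 0"
      by (intro tendsto_ennrealI LIMSEQ_Suc[OF lim_const_over_n])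
    ultimately have "emeasure ?M Nl \<le> ennreal 0"
      by (intro LIMSEQ_le_const) auto
    then show "emeasure ?M Nl = 0" by simp
  qed
  then show ?thesis
  proof (rule AE_I')
    show "{x \<in> space ?M. \<not> (\<forall>p\<in>E. \<exists>i\<in>I. x i \<noteq> \<phi> p i)} \<subseteq> Nl"
      using cover by (fastforce simp: Nl_def)
  qed
qed

section \<open>Dual families\<close>

text \<open>Take \<open>T\<close> maximal among the subsets of \<open>U\<close> that admit dual
  functionals. A vector not fixed by the resulting projection onto the span of \<open>T\<close>
  would allow a larger \<open>T\<close>.\<close>

lemma dual_family:
  fixes v :: "'u \<Rightarrow> nat \<Rightarrow> 'a::field" and A :: "nat set"
  assumes "finite U" "finite A"
  obtains T G where "T \<subseteq> U"
    and "\<And>s t. s \<in> T \<Longrightarrow> t \<in> T \<Longrightarrow> (\<Sum>n\<in>A. G s n * v t n) = (if s = t then 1 else 0)"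
    and "\<And>u n. u \<in> U \<Longrightarrow> n \<in> A \<Longrightarrow> v u n = (\<Sum>t\<in>T. (\<Sum>m\<in>A. G t m * v u m) * v t n)"
proof -
  define P where "P T G \<longleftrightarrow> T \<subseteq> U \<and>
    (\<forall>s\<in>T. \<forall>t\<in>T. (\<Sum>n\<in>A. G s n * v t n) = (if s = t then 1 else 0))" for T and G :: "'u \<Rightarrow> nat \<Rightarrow> 'a"
  define Q where "Q = {T. \<exists>G. P T G}"
  have "finite Q" by (rule finite_subset[of _ "Pow U"]) (use assms in \<open>auto simp: Q_def P_def\<close>)
  moreover have "{} \<in> Q" by (auto simp: Q_def P_def)
  ultimately obtain T where TQ: "T \<in> Q" and mx: "\<And>T'. T' \<in> Q \<Longrightarrow> T \<subseteq> T' \<Longrightarrow> T = T'"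
    using finite_has_maximal[of Q] by blast
  then obtain G where PG: "P T G" by (auto simp: Q_def)
  have TU: "T \<subseteq> U" and G: "\<And>s t. s \<in> T \<Longrightarrow> t \<in> T \<Longrightarrow> (\<Sum>n\<in>A. G s n * v t n) = (if s = t then 1 else 0)"
    using PG by (auto simp: P_def)
  have finT: "finite T" using TU assms finite_subset by blast
  have "v u n0 = (\<Sum>t\<in>T. (\<Sum>m\<in>A. G t m * v u m) * v t n0)" if u: "u \<in> U" and n0: "n0 \<in> A" for u n0
  proof (rule ccontr)
    assume ne: "v u n0 \<noteq> (\<Sum>t\<in>T. (\<Sum>m\<in>A. G t m * v u m) * v t n0)"
    \<comment> \<open>This functional is entry \<open>n0\<close> of a vector minus its projection:
      it vanishes on \<open>T\<close> but not on \<open>v u\<close>.\<close>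
    define g where "g n = (if n = n0 then 1 else 0) - (\<Sum>t\<in>T. v t n0 * G t n)" for n
    define h where "h = (\<Sum>n\<in>A. g n * v u n)"
    have g_sum: "(\<Sum>n\<in>A. g n * w n) = w n0 - (\<Sum>t\<in>T. (\<Sum>m\<in>A. G t m * w m) * v t n0)" for w
    proof -
      have "(\<Sum>n\<in>A. g n * w n) = (\<Sum>n\<in>A. (if n = n0 then w n else 0)) - (\<Sum>n\<in>A. \<Sum>t\<in>T. v t n0 * G t n * w n)"
        by (subst sum_subtractf[symmetric], rule sum.cong)
           (auto simp: g_def algebra_simps sum_distrib_left sum_distrib_right)
      also have "(\<Sum>n\<in>A. (if n = n0 then w n else 0)) = w n0" using n0 assms by simp
      also have "(\<Sum>n\<in>A. \<Sum>t\<in>T. v t n0 * G t n * w n) = (\<Sum>t\<in>T. (\<Sum>m\<in>A. G t m * w m) * v t n0)"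
        by (subst sum.swap) (simp add: sum_distrib_left sum_distrib_right mult_ac)
      finally show ?thesis .
    qed
    have h0: "h \<noteq> 0" using ne by (simp add: h_def g_sum)
    have gT: "(\<Sum>n\<in>A. g n * v t n) = 0" if "t \<in> T" for t
    proof -
      have "(\<Sum>s\<in>T. (\<Sum>m\<in>A. G s m * v t m) * v s n0) = (\<Sum>s\<in>T. if s = t then v s n0 else 0)"
        by (intro sum.cong) (auto simp: G that)
      then show ?thesis using that finT by (simp add: g_sum)
    qed
    have uT: "u \<notin> T" using gT h0 by (auto simp: h_def)
    \<comment> \<open>Normalised by \<open>h\<close>, the functional \<open>g\<close> is dual to
      \<open>u\<close>; the old functionals are corrected by multiples of it so as to vanish on
      \<open>v u\<close>.\<close>
    define G' where "G' s n = (if s = u then g n / h else G s n - (\<Sum>m\<in>A. G s m * v u m) * (g n / h))" for s n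
    have sum2: "(\<Sum>n\<in>A. (G s n - z * (g n / h)) * w n) = (\<Sum>n\<in>A. G s n * w n) - z * ((\<Sum>n\<in>A. g n * w n) / h)" for s z w
      by (simp add: sum_divide_distrib sum_distrib_left algebra_simps sum_subtractf)
    have "P (insert u T) G'"
      unfolding P_def
    proof (intro conjI ballI)
      show "insert u T \<subseteq> U" using u TU by auto
      fix s t assume s: "s \<in> insert u T" and t: "t \<in> insert u T"
      show "(\<Sum>n\<in>A. G' s n * v t n) = (if s = t then 1 else 0)"
      proof (cases "s = u")
        case True
        then show ?thesis using t gT h0 uT by (cases "t = u") (auto simp: G'_def h_def simp flip: sum_divide_distrib)
      next
        case False
        then have sT: "s \<in> T" using s by simp
        have "(\<Sum>n\<in>A. G' s n * v t n)
            = (\<Sum>n\<in>A. G s n * v t n) - (\<Sum>m\<in>A. G s m * v u m) * ((\<Sum>n\<in>A. g n * v t n) / h)"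
          using False sum2[of s "\<Sum>m\<in>A. G s m * v u m" "v t"] by (simp add: G'_def)
        then show ?thesis using sT t gT h0 G False by (cases "t = u") (auto simp flip: h_def)
      qed
    qed
    then have "insert u T \<in> Q" by (auto simp: Q_def)
    then show False using mx uT by blast
  qed
  with that TU G show thesis by blast
qed

text \<open>The rows of the identity minus the projection onto the span annihilate all vectors.
  Either one of these rows is nonzero, or the projection is the identity and its trace yields
  \<open>card T = card A\<close>; characteristic zero turns this equation of scalars into one of
  natural numbers.\<close>

lemma dual_basis_or_annihilator:
  fixes v :: "'u \<Rightarrow> nat \<Rightarrow> 'a::field_char_0" and A :: "nat set"
  assumes fin: "finite U" "finite A"
  obtains (annihilator) w where "\<exists>n\<in>A. w n \<noteq> 0" and "\<And>u. u \<in> U \<Longrightarrow> (\<Sum>n\<in>A. w n * v u n) = 0"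
  | (dual) T G where "T \<subseteq> U" and "card T = card A"
    and "\<And>s t. s \<in> T \<Longrightarrow> t \<in> T \<Longrightarrow> (\<Sum>n\<in>A. G s n * v t n) = (if s = t then 1 else 0)"
proof -
  obtain T G where T: "T \<subseteq> U"
    and G: "\<And>s t. s \<in> T \<Longrightarrow> t \<in> T \<Longrightarrow> (\<Sum>n\<in>A. G s n * v t n) = (if s = t then 1 else 0)"
    and span: "\<And>u n. u \<in> U \<Longrightarrow> n \<in> A \<Longrightarrow> v u n = (\<Sum>t\<in>T. (\<Sum>m\<in>A. G t m * v u m) * v t n)"
    using dual_family[OF fin, of v] by blast
  have finT: "finite T" using T fin finite_subset by blast
  define w where "w n m = (if m = n then 1 else 0) - (\<Sum>t\<in>T. v t n * G t m)" for n m
  have ann: "(\<Sum>m\<in>A. w n m * v u m) = 0" if "u \<in> U" "n \<in> A" for u n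
  proof -
    have "(\<Sum>m\<in>A. w n m * v u m) = (\<Sum>m\<in>A. (if m = n then v u m else 0)) - (\<Sum>m\<in>A. \<Sum>t\<in>T. v t n * G t m * v u m)"
      by (subst sum_subtractf[symmetric], rule sum.cong)
         (auto simp: w_def algebra_simps sum_distrib_left sum_distrib_right)
    also have "(\<Sum>m\<in>A. (if m = n then v u m else 0)) = v u n" using that fin by simp
    also have "(\<Sum>m\<in>A. \<Sum>t\<in>T. v t n * G t m * v u m) = (\<Sum>t\<in>T. (\<Sum>m\<in>A. G t m * v u m) * v t n)"
      by (subst sum.swap) (simp add: sum_distrib_left sum_distrib_right mult_ac)
    finally show ?thesis using span[OF that] by simp
  qed
  show thesis
  proof (cases "\<exists>n\<in>A. \<exists>m\<in>A. w n m \<noteq> 0")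
    case True
    then show ?thesis using annihilator ann by blast
  next
    case False
    then have "w n n = 0" if "n \<in> A" for n
      using that by blast
    then have "(\<Sum>t\<in>T. v t n * G t n) = 1" if "n \<in> A" for n
      using that by (simp add: w_def)
    \<comment> \<open>The trace of the identity, written as a sum of rank-one projections, counts \<open>T\<close>.\<close>
    then have "of_nat (card A) = (\<Sum>n\<in>A. \<Sum>t\<in>T. v t n * G t n)" by simp
    also have "\<dots> = (\<Sum>t\<in>T. \<Sum>n\<in>A. G t n * v t n)"
      by (subst sum.swap) (simp add: mult.commute)
    also have "\<dots> = of_nat (card T)" by (simp add: G)
    finally have "card T = card A" by (metis of_nat_eq_iff)
    then show ?thesis using dual T G by blast
  qed
qed

section \<open>Vanishing orders via the Euler operator\<close>

text \<open>The operator \<open>x d/dx\<close>. Unlike \<open>pderiv\<close> it multiplies the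
  coefficient at \<open>n\<close> by \<open>n\<close>, which produces the powers \<open>n^j\<close>
  of the modes.\<close>

definition euler_op :: "'a::field_char_0 poly \<Rightarrow> 'a poly" where
  "euler_op p = pCons 0 (pderiv p)"

lemma coeff_euler_op: "poly.coeff (euler_op p) n = of_nat n * poly.coeff p n"
  by (cases n) (auto simp: euler_op_def coeff_pderiv)

lemma coeff_euler_op_funpow: "poly.coeff ((euler_op ^^ j) p) n = of_nat n ^ j * poly.coeff p n"
  by (induction j) (auto simp: coeff_euler_op mult_ac)

lemma degree_euler_op_funpow: "degree ((euler_op ^^ j) p) \<le> degree p"
  by (rule degree_le) (auto simp: coeff_euler_op_funpow coeff_eq_0)

lemma poly_altdef':
  fixes p :: "'a::field_char_0 poly"
  shows "degree p \<le> N \<Longrightarrow> poly p x = (\<Sum>n\<le>N. poly.coeff p n * x ^ n)"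
  unfolding poly_altdef by (intro sum.mono_neutral_left) (auto simp: coeff_eq_0)

text \<open>Pairing coefficients with a sampled mode amounts to evaluating an iterated Euler
  derivative. The constant coefficient has to vanish because the samples start at
  \<open>n = 1\<close>.\<close>

lemma poly_euler_op_funpow:
  assumes "degree p \<le> N" "poly.coeff p 0 = 0"
  shows "poly ((euler_op ^^ j) p) x = (\<Sum>n\<in>{1..N}. poly.coeff p n * (of_nat n ^ j * x ^ n))"
proof -
  have "poly ((euler_op ^^ j) p) x = (\<Sum>n\<le>N. poly.coeff ((euler_op ^^ j) p) n * x ^ n)"
    using degree_euler_op_funpow[of j p] assms(1) by (intro poly_altdef') auto
  also have "\<dots> = (\<Sum>n\<in>{1..N}. poly.coeff p n * (of_nat n ^ j * x ^ n))"
    using assms(2) by (intro sum.mono_neutral_cong_right) (auto simp: coeff_euler_op_funpow mult_ac not_less_eq_eq)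
  finally show ?thesis .
qed

text \<open>In characteristic zero \<open>pderiv\<close> lowers the order of a root by exactly one,
  and the extra factor \<open>x\<close> does not vanish at a nonzero point.\<close>

lemma order_euler_op:
  fixes x :: "'a::field_char_0"
  assumes "p \<noteq> 0" "poly p x = 0" "x \<noteq> 0"
  shows "euler_op p \<noteq> 0" "Polynomial.order x p = Suc (Polynomial.order x (euler_op p))"
proof -
  have nz: "pderiv p \<noteq> 0"
  proof
    assume "pderiv p = 0"
    then obtain c where "p = [:c:]" using pderiv_iszero by blast
    then show False using assms by auto
  qed
  then show "euler_op p \<noteq> 0" by (auto simp: euler_op_def)
  have eq: "euler_op p = [:0, 1:] * pderiv p" by (simp add: euler_op_def)
  have "Polynomial.order x (euler_op p) = Polynomial.order x [:0, 1:] + Polynomial.order x (pderiv p)"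
    unfolding eq by (rule order_mult) (use nz in auto)
  also have "Polynomial.order x [:0, 1:] = 0" using assms(3) by (intro order_0I) auto
  finally show "Polynomial.order x p = Suc (Polynomial.order x (euler_op p))"
    using order_pderiv[OF assms(1,2)] by simp
qed

text \<open>By induction on \<open>d\<close>: as long as the value at \<open>x\<close> is zero, each
  Euler derivative lowers the order there by one.\<close>

lemma euler_op_funpow_roots_iff:
  fixes x :: "'a::field_char_0"
  assumes "p \<noteq> 0" "x \<noteq> 0"
  shows "(\<forall>j\<le>d. poly ((euler_op ^^ j) p) x = 0) \<longleftrightarrow> d < Polynomial.order x p"
  using assms(1)
proof (induction d arbitrary: p)
  case 0
  then show ?case using order_root[of p x] by auto
next
  case (Suc d)
  have split: "(\<forall>j\<le>Suc d. P j) \<longleftrightarrow> P 0 \<and> (\<forall>j\<le>d. P (Suc j))" for P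
    by (metis Suc_le_mono le0 not0_implies_Suc)
  show ?case
  proof (cases "poly p x = 0")
    case True
    note o = order_euler_op[OF Suc.prems True assms(2)]
    show ?thesis unfolding split using Suc.IH[OF o(1)] True o(2)
      by (simp add: funpow_swap1)
  next
    case False
    then show ?thesis unfolding split using order_0I[OF False] by auto
  qed
qed

section \<open>Counting parameters of relations between sources\<close>

definition bdd_lip :: "'p set \<Rightarrow> ('p \<Rightarrow> 'p \<Rightarrow> real) \<Rightarrow> ('p \<Rightarrow> 'a::real_normed_field) \<Rightarrow> bool" where
  "bdd_lip E \<delta> g \<longleftrightarrow> (\<exists>M. \<forall>p\<in>E. norm (g p) \<le> M) \<and> (\<exists>L. \<forall>p\<in>E. \<forall>q\<in>E. norm (g p - g q) \<le> L * \<delta> p q)"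

lemma bdd_lipI:
  assumes "\<And>p. p \<in> E \<Longrightarrow> norm (g p) \<le> M" "\<And>p q. p \<in> E \<Longrightarrow> q \<in> E \<Longrightarrow> norm (g p - g q) \<le> L * \<delta> p q"
  shows "bdd_lip E \<delta> g"
  using assms unfolding bdd_lip_def by blast

lemma bdd_lipE:
  assumes "bdd_lip E \<delta> g" and nn: "\<And>p q. 0 \<le> \<delta> p q"
  obtains M L where "0 \<le> M" "0 \<le> L" "\<And>p. p \<in> E \<Longrightarrow> norm (g p) \<le> M"
    "\<And>p q. p \<in> E \<Longrightarrow> q \<in> E \<Longrightarrow> norm (g p - g q) \<le> L * \<delta> p q"
proof -
  obtain M L where M: "\<And>p. p \<in> E \<Longrightarrow> norm (g p) \<le> M"
    and L: "\<And>p q. p \<in> E \<Longrightarrow> q \<in> E \<Longrightarrow> norm (g p - g q) \<le> L * \<delta> p q"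
    using assms(1) unfolding bdd_lip_def by blast
  show thesis
  proof (rule that[of "max M 0" "max L 0"])
    show "norm (g p - g q) \<le> max L 0 * \<delta> p q" if "p \<in> E" "q \<in> E" for p q
      using L[OF that] mult_right_mono[OF max.cobounded1[of L 0] nn[of p q]] by linarith
  qed (use M in \<open>auto simp: le_max_iff_disj\<close>)
qed

lemma bdd_lip_lipschitz:
  assumes "bdd_lip E \<delta> g" "\<And>p q. 0 \<le> \<delta> p q"
  shows "\<exists>L\<ge>0. \<forall>p\<in>E. \<forall>q\<in>E. norm (g p - g q) \<le> L * \<delta> p q"
  by (rule bdd_lipE[OF assms]) blast

context
  fixes \<delta> :: "'p \<Rightarrow> 'p \<Rightarrow> real"
  assumes nn: "\<And>p q. 0 \<le> \<delta> p q"
begin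

lemma bdd_lip_const: "bdd_lip E \<delta> (\<lambda>_. k)"
  by (rule bdd_lipI[of _ _ "norm k" 0]) auto

lemma bdd_lip_add:
  assumes "bdd_lip E \<delta> g" "bdd_lip E \<delta> h"
  shows "bdd_lip E \<delta> (\<lambda>p. g p + h p)"
proof -
  obtain M L where 1: "\<And>p. p \<in> E \<Longrightarrow> norm (g p) \<le> M"
    "\<And>p q. p \<in> E \<Longrightarrow> q \<in> E \<Longrightarrow> norm (g p - g q) \<le> L * \<delta> p q"
    using bdd_lipE[OF assms(1) nn] by metis
  obtain M' L' where 2: "\<And>p. p \<in> E \<Longrightarrow> norm (h p) \<le> M'"
    "\<And>p q. p \<in> E \<Longrightarrow> q \<in> E \<Longrightarrow> norm (h p - h q) \<le> L' * \<delta> p q"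
    using bdd_lipE[OF assms(2) nn] by metis
  show ?thesis
  proof (rule bdd_lipI[of _ _ "M + M'" "L + L'"])
    show "norm (g p + h p) \<le> M + M'" if "p \<in> E" for p
      using norm_triangle_ineq[of "g p" "h p"] 1(1)[OF that] 2(1)[OF that] by linarith
    show "norm (g p + h p - (g q + h q)) \<le> (L + L') * \<delta> p q" if "p \<in> E" "q \<in> E" for p q
      using norm_triangle_ineq[of "g p - g q" "h p - h q"] 1(2)[OF that] 2(2)[OF that]
      by (simp add: algebra_simps)
  qed
qed

text \<open>This product rule is the reason why boundedness is carried along with the Lipschitz
  estimate.\<close>

lemma bdd_lip_mult:
  assumes "bdd_lip E \<delta> g" "bdd_lip E \<delta> h"
  shows "bdd_lip E \<delta> (\<lambda>p. g p * h p)"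
proof -
  obtain M L where 1: "0 \<le> M" "0 \<le> L" "\<And>p. p \<in> E \<Longrightarrow> norm (g p) \<le> M"
    "\<And>p q. p \<in> E \<Longrightarrow> q \<in> E \<Longrightarrow> norm (g p - g q) \<le> L * \<delta> p q"
    using bdd_lipE[OF assms(1) nn] by metis
  obtain M' L' where 2: "0 \<le> M'" "0 \<le> L'" "\<And>p. p \<in> E \<Longrightarrow> norm (h p) \<le> M'"
    "\<And>p q. p \<in> E \<Longrightarrow> q \<in> E \<Longrightarrow> norm (h p - h q) \<le> L' * \<delta> p q"
    using bdd_lipE[OF assms(2) nn] by metis
  show ?thesis
  proof (rule bdd_lipI[of _ _ "M * M'" "L * M' + M * L'"])
    show "norm (g p * h p) \<le> M * M'" if "p \<in> E" for p
      unfolding norm_mult using 1 2 that by (intro mult_mono) auto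
    show "norm (g p * h p - g q * h q) \<le> (L * M' + M * L') * \<delta> p q" if pq: "p \<in> E" "q \<in> E" for p q
    proof -
      have "g p * h p - g q * h q = (g p - g q) * h p + g q * (h p - h q)"
        by (simp add: algebra_simps)
      then have "norm (g p * h p - g q * h q) \<le> norm (g p - g q) * norm (h p) + norm (g q) * norm (h p - h q)"
        by (metis norm_mult norm_triangle_ineq)
      also have "\<dots> \<le> (L * \<delta> p q) * M' + M * (L' * \<delta> p q)"
        using 1 2 pq nn by (intro add_mono mult_mono) auto
      finally show ?thesis by (simp add: algebra_simps)
    qed
  qed
qed

lemma bdd_lip_minus: "bdd_lip E \<delta> g \<Longrightarrow> bdd_lip E \<delta> (\<lambda>p. - g p)"
  using bdd_lip_mult[OF bdd_lip_const[of E "-1"]] by fastforce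

lemma bdd_lip_power: "bdd_lip E \<delta> g \<Longrightarrow> bdd_lip E \<delta> (\<lambda>p. g p ^ n)"
  by (induction n) (auto intro: bdd_lip_const bdd_lip_mult)

lemma bdd_lip_sum: "(\<And>i. i \<in> I \<Longrightarrow> bdd_lip E \<delta> (g i)) \<Longrightarrow> bdd_lip E \<delta> (\<lambda>p. \<Sum>i\<in>I. g i p)"
  by (induction I rule: infinite_finite_induct) (auto intro: bdd_lip_const bdd_lip_add)

text \<open>Subtracting the systems at \<open>p\<close> and \<open>q\<close> gives a linear system
  for the difference of the solutions, with the matrix at \<open>p\<close>; the left inverse
  \<open>G\<close> at \<open>p\<close> solves it. So a bound on \<open>G\<close> suffices, with no
  Lipschitz estimate for it.\<close>

lemma bdd_lip_linear_solution:
  assumes fin: "finite T"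
    and a: "\<And>t n. t \<in> T \<Longrightarrow> n \<in> A \<Longrightarrow> bdd_lip E \<delta> (a t n)"
    and h: "\<And>n. n \<in> A \<Longrightarrow> bdd_lip E \<delta> (h n)"
    and G: "\<And>p s n. p \<in> E \<Longrightarrow> s \<in> T \<Longrightarrow> n \<in> A \<Longrightarrow> norm (G s n p) \<le> B"
    and y: "\<And>p t. p \<in> E \<Longrightarrow> t \<in> T \<Longrightarrow> norm (y t p) \<le> B'"
    and eq: "\<And>p n. p \<in> E \<Longrightarrow> n \<in> A \<Longrightarrow> (\<Sum>t\<in>T. y t p * a t n p) = h n p"
    and dual: "\<And>p s t. p \<in> E \<Longrightarrow> s \<in> T \<Longrightarrow> t \<in> T \<Longrightarrow>
      (\<Sum>n\<in>A. G s n p * a t n p) = (if s = t then 1 else 0)"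
    and s: "s \<in> T"
  shows "bdd_lip E \<delta> (y s)"
proof -
  have "\<forall>n\<in>A. \<exists>L\<ge>0. \<forall>p\<in>E. \<forall>q\<in>E. norm (h n p - h n q) \<le> L * \<delta> p q"
    by (intro ballI bdd_lip_lipschitz h nn)
  then obtain Lh where Lh: "\<And>n p q. n \<in> A \<Longrightarrow> p \<in> E \<Longrightarrow> q \<in> E \<Longrightarrow> norm (h n p - h n q) \<le> Lh n * \<delta> p q"
    by metis
  have "\<forall>t\<in>T. \<forall>n\<in>A. \<exists>L\<ge>0. \<forall>p\<in>E. \<forall>q\<in>E. norm (a t n p - a t n q) \<le> L * \<delta> p q"
    by (intro ballI bdd_lip_lipschitz a nn)
  then obtain La where La: "\<And>t n p q. t \<in> T \<Longrightarrow> n \<in> A \<Longrightarrow> p \<in> E \<Longrightarrow> q \<in> E \<Longrightarrow> norm (a t n p - a t n q) \<le> La t n * \<delta> p q"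
    by metis
  show ?thesis
  proof (rule bdd_lipI[of _ _ B' "\<Sum>n\<in>A. B * (Lh n + (\<Sum>t\<in>T. B' * La t n))"])
    show "norm (y s p - y s q) \<le> (\<Sum>n\<in>A. B * (Lh n + (\<Sum>t\<in>T. B' * La t n))) * \<delta> p q" if pq: "p \<in> E" "q \<in> E" for p q
    proof -
      define D where "D n = (\<Sum>t\<in>T. (y t p - y t q) * a t n p)" for n
      have D: "D n = h n p - h n q - (\<Sum>t\<in>T. y t q * (a t n p - a t n q))" if "n \<in> A" for n
        using eq[OF pq(1) that] eq[OF pq(2) that]
        by (simp add: D_def algebra_simps sum_subtractf)
      have "(\<Sum>n\<in>A. G s n p * D n) = (\<Sum>t\<in>T. (y t p - y t q) * (\<Sum>n\<in>A. G s n p * a t n p))"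
        unfolding D_def sum_distrib_left by (subst sum.swap) (simp add: mult_ac)
      also have "\<dots> = (\<Sum>t\<in>T. if t = s then y t p - y t q else 0)"
        by (intro sum.cong refl) (auto simp: dual pq s)
      also have "\<dots> = y s p - y s q" using fin s by simp
      finally have "norm (y s p - y s q) = norm (\<Sum>n\<in>A. G s n p * D n)" by simp
      also have "\<dots> \<le> (\<Sum>n\<in>A. B * ((Lh n + (\<Sum>t\<in>T. B' * La t n)) * \<delta> p q))"
      proof (rule sum_norm_le)
        fix n assume n: "n \<in> A"
        have B0: "0 \<le> B" using G[OF pq(1) s n] norm_ge_zero order_trans by blast
        have B'0: "0 \<le> B'" using y[OF pq(1) s] norm_ge_zero order_trans by blast
        have "norm (\<Sum>t\<in>T. y t q * (a t n p - a t n q)) \<le> (\<Sum>t\<in>T. B' * (La t n * \<delta> p q))"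
          by (intro sum_norm_le) (auto simp: norm_mult intro!: mult_mono y La pq n B'0)
        then have "norm (D n) \<le> Lh n * \<delta> p q + (\<Sum>t\<in>T. B' * (La t n * \<delta> p q))"
          unfolding D[OF n]
          using norm_triangle_ineq4[of "h n p - h n q" "\<Sum>t\<in>T. y t q * (a t n p - a t n q)"] Lh[OF n pq]
          by linarith
        also have "\<dots> = (Lh n + (\<Sum>t\<in>T. B' * La t n)) * \<delta> p q"
          by (simp add: algebra_simps sum_distrib_left)
        finally show "norm (G s n p * D n) \<le> B * ((Lh n + (\<Sum>t\<in>T. B' * La t n)) * \<delta> p q)"
          unfolding norm_mult using G[OF pq(1) s n] B0 by (intro mult_mono) auto
      qed
      finally show ?thesis by (simp add: sum_distrib_left sum_distrib_right mult_ac)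
    qed
  qed (use y s in auto)
qed

end

text \<open>A pole enters a source nonlinearly and has no mode of its own; the value 0 lets sums
  range over all of \<open>coords F d\<close>.\<close>

fun mode :: "(coord \<Rightarrow> 'a::comm_semiring_1) \<Rightarrow> coord \<Rightarrow> nat \<Rightarrow> 'a" where
  "mode z (Pole f) n = 0"
| "mode z (Coeff j f) n = of_nat n ^ j * z (Pole f) ^ n"

lemma sum_coords:
  "(\<Sum>c\<in>coords F d. g c) = (\<Sum>f<F. g (Pole f)) + (\<Sum>f<F. \<Sum>j\<le>d f. g (Coeff j f))"
proof -
  have "(\<Sum>c\<in>coords F d. g c) = sum g (Pole ` {..<F}) + sum g ((\<lambda>(f, j). Coeff j f) ` (SIGMA f:{..<F}. {..d f}))"
    unfolding coords_alt by (intro sum.union_disjoint) auto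
  also have "sum g (Pole ` {..<F}) = (\<Sum>f<F. g (Pole f))"
    by (subst sum.reindex) (auto simp: inj_on_def)
  also have "sum g ((\<lambda>(f, j). Coeff j f) ` (SIGMA f:{..<F}. {..d f})) = (\<Sum>f<F. \<Sum>j\<le>d f. g (Coeff j f))"
    by (subst sum.reindex) (auto simp: inj_on_def sum.Sigma case_prod_unfold)
  finally show ?thesis .
qed

lemma source_eq_sum_modes: "source F d z n = (\<Sum>c\<in>coords F d. z c * mode z c n)"
  by (simp add: source_def sum_coords sum_distrib_left sum_distrib_right mult_ac)

definition rescale :: "'a::times \<Rightarrow> (coord \<Rightarrow> 'a) \<Rightarrow> coord \<Rightarrow> 'a" where
  "rescale k z c = (case c of Pole f \<Rightarrow> z c | Coeff j f \<Rightarrow> k * z c)"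

lemma source_rescale: "source F d (rescale k z) n = k * source F d z n"
  by (simp add: source_def rescale_def sum_distrib_left sum_distrib_right mult_ac)

text \<open>A relation \<open>\<Sum>r\<in>P. c r * s\<^sub>r = s\<close> with \<open>c r0 = 1\<close> is stored as \<open>(\<eta>, e, G)\<close>: row \<open>r \<in> P\<close> of \<open>\<eta>\<close> is
  \<open>c r * s\<^sub>r\<close>, row \<open>R\<close> is \<open>- s\<close>, the other rows are the unchanged \<open>s\<^sub>r\<close>, \<open>S = insert R P\<close>, and \<open>e r = 1 / c r\<close>
  recovers the original sources.
  \<open>G\<close> witnesses the independence of the modes in \<open>T\<close>, and \<open>B\<close> bounds everything so that the
  coordinates in \<open>T\<close> are Lipschitz in the others.\<close>

definition relations :: "nat \<Rightarrow> nat \<Rightarrow> nat \<Rightarrow> (nat \<Rightarrow> nat) \<Rightarrow> nat set \<Rightarrow> nat \<Rightarrow> (nat \<times> coord) set \<Rightarrow> real \<Rightarrow>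
    ((nat \<times> coord \<Rightarrow> 'a::real_normed_field) \<times> (nat \<Rightarrow> 'a) \<times> (nat \<times> coord \<Rightarrow> nat \<Rightarrow> 'a)) set" where
  "relations N R F d S r0 T B = {(\<eta>, e, G).
     (\<forall>u\<in>{..R} \<times> coords F d. norm (\<eta> u) \<le> B) \<and> (\<forall>r<R. norm (e r) \<le> B) \<and>
     (\<forall>t\<in>T. \<forall>n\<in>{1..N}. norm (G t n) \<le> B) \<and> e r0 = 1 \<and>
     (\<forall>s\<in>T. \<forall>t\<in>T. (\<Sum>n\<in>{1..N}. G s n * mode (\<lambda>c. \<eta> (fst t, c)) (snd t) n) = (if s = t then 1 else 0)) \<and>
     (\<forall>n\<in>{1..N}. (\<Sum>u\<in>S \<times> coords F d. \<eta> u * mode (\<lambda>c. \<eta> (fst u, c)) (snd u) n) = 0)}"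

text \<open>Let \<open>l = card (coords F d)\<close>. The array \<eta> has
  \<open>(R + 1) * l\<close> entries, of which \<open>N\<close> are determined by the others, and
  the scalars \<open>e r\<close> contribute \<open>R - 1\<close> more because
  \<open>e r0 = 1\<close>. The total is less than \<open>R * l\<close> exactly when
  \<open>R + l \<le> N\<close>.\<close>

lemma AE_no_relation:
  fixes B :: real
  assumes R: "r0 < R" "R + card (coords F d) \<le> N"
    and S: "S \<subseteq> {..R}" and T: "T \<subseteq> S \<times> coords F d" "card T = N"
  shows "AE \<zeta> in (param_measure R F d :: (nat \<times> coord \<Rightarrow> 'a::{real_normed_field,euclidean_space}) measure).
    \<forall>(\<eta>, e, G) \<in> relations N R F d S r0 T B.
      \<exists>(r, c) \<in> {..<R} \<times> coords F d. \<zeta> (r, c) \<noteq> rescale (e r) (\<lambda>c. \<eta> (r, c)) c"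
proof -
  define X where "X = coords F d"
  define J where "J = Inl ` ({..R} \<times> X - T) \<union> Inr ` ({..<R} - {r0})"
  define I where "I = {..<R} \<times> X"
  define E :: "((nat \<times> coord \<Rightarrow> 'a) \<times> (nat \<Rightarrow> 'a) \<times> (nat \<times> coord \<Rightarrow> nat \<Rightarrow> 'a)) set"
    where "E = relations N R F d S r0 T B"
  define \<pi> :: "(nat \<times> coord \<Rightarrow> 'a) \<times> (nat \<Rightarrow> 'a) \<times> (nat \<times> coord \<Rightarrow> nat \<Rightarrow> 'a) \<Rightarrow> (nat \<times> coord) + nat \<Rightarrow> 'a"
    where "\<pi> p = case_sum (fst p) (fst (snd p))" for p
  define \<phi> :: "(nat \<times> coord \<Rightarrow> 'a) \<times> (nat \<Rightarrow> 'a) \<times> (nat \<times> coord \<Rightarrow> nat \<Rightarrow> 'a) \<Rightarrow> nat \<times> coord \<Rightarrow> 'a"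
    where "\<phi> p i = rescale (fst (snd p) (fst i)) (\<lambda>c. fst p (fst i, c)) (snd i)" for p i
  define \<delta> where "\<delta> p q = (\<Sum>j\<in>J. norm (\<pi> p j - \<pi> q j))" for p q
  have finX: "finite X" by (simp add: X_def finite_coords)
  have finJ: "finite J" and finI: "finite I" using finX by (auto simp: J_def I_def)
  have finT: "finite T" using T(1) finX S by (auto simp: X_def[symmetric] intro: finite_subset[of _ "{..R} \<times> X"])
  have TX: "T \<subseteq> {..R} \<times> X" using T S by (auto simp: X_def)
  have cardJ: "card J < card I"
  proof -
    have "card J = card ({..R} \<times> X - T) + card ({..<R} - {r0})"
      unfolding J_def using finX by (subst card_Un_disjoint) (auto simp: card_image)
    also have "card ({..R} \<times> X - T) = Suc R * card X - N"
      using TX T(2) finT by (subst card_Diff_subset) (auto simp: card_cartesian_product)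
    also have "card ({..<R} - {r0}) = R - 1" using R by simp
    finally have "card J = Suc R * card X - N + (R - 1)" .
    moreover have "N \<le> Suc R * card X"
      using card_mono[OF _ TX] finX T(2) by (simp add: card_cartesian_product)
    ultimately show ?thesis using R by (simp add: I_def card_cartesian_product X_def)
  qed
  have nn: "0 \<le> \<delta> p q" for p q by (auto simp: \<delta>_def intro: sum_nonneg)
  have EB: "\<And>p u. p \<in> E \<Longrightarrow> u \<in> {..R} \<times> X \<Longrightarrow> norm (fst p u) \<le> B"
    "\<And>p r. p \<in> E \<Longrightarrow> r < R \<Longrightarrow> norm (fst (snd p) r) \<le> B"
    "\<And>p t n. p \<in> E \<Longrightarrow> t \<in> T \<Longrightarrow> n \<in> {1..N} \<Longrightarrow> norm (snd (snd p) t n) \<le> B"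
    "\<And>p. p \<in> E \<Longrightarrow> fst (snd p) r0 = 1"
    "\<And>p s t. p \<in> E \<Longrightarrow> s \<in> T \<Longrightarrow> t \<in> T \<Longrightarrow> (\<Sum>n\<in>{1..N}. snd (snd p) s n * mode (\<lambda>c. fst p (fst t, c)) (snd t) n) = (if s = t then 1 else 0)"
    "\<And>p n. p \<in> E \<Longrightarrow> n \<in> {1..N} \<Longrightarrow> (\<Sum>u\<in>S \<times> X. fst p u * mode (\<lambda>c. fst p (fst u, c)) (snd u) n) = 0"
    unfolding E_def relations_def X_def by (auto simp: case_prod_unfold)
  have bd: "norm (\<pi> p j) \<le> B" if "p \<in> E" "j \<in> J" for p j
    using that EB(1)[of p] EB(2)[of p] by (auto simp: J_def \<pi>_def)
  have coordinate: "norm (\<pi> p j - \<pi> q j) \<le> 1 * \<delta> p q" if "j \<in> J" for p q j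
    using member_le_sum[OF that, of "\<lambda>j. norm (\<pi> p j - \<pi> q j)"] finJ by (simp add: \<delta>_def)
  have lip_free: "bdd_lip E \<delta> (\<lambda>p. fst p u)" if "u \<in> {..R} \<times> X - T" for u
    by (rule bdd_lipI[of _ _ B 1])
      (use that EB(1) coordinate[of "Inl u"] in \<open>auto simp: J_def \<pi>_def\<close>)
  have lip_e: "bdd_lip E \<delta> (\<lambda>p. fst (snd p) r)" if "r < R" for r
  proof (cases "r = r0")
    case True
    then show ?thesis by (intro bdd_lipI[of _ _ 1 0]) (auto simp: EB(4))
  next
    case False
    then show ?thesis
      by (intro bdd_lipI[of _ _ B 1]) (use that EB(2) coordinate[of "Inr r"] in \<open>auto simp: J_def \<pi>_def\<close>)
  qed
  show ?thesis
  proof (cases "\<exists>r f. (r, Pole f) \<in> T")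
    case True
    \<comment> \<open>The mode of a pole is zero, so no functional can be dual to it.\<close>
    then have "E = {}" using EB(5) by fastforce
    then show ?thesis by (simp add: E_def)
  next
    case noPole: False
    have lip_mode: "bdd_lip E \<delta> (\<lambda>p. mode (\<lambda>c. fst p (fst u, c)) (snd u) n)" if "u \<in> {..R} \<times> X" for u n
    proof (cases "snd u")
      case (Pole f)
      then show ?thesis by (simp add: bdd_lip_const nn)
    next
      case (Coeff j f)
      then have "(fst u, Pole f) \<in> {..R} \<times> X - T" using that noPole by (auto simp: X_def coords_def)
      then show ?thesis unfolding Coeff mode.simps
        by (intro bdd_lip_mult bdd_lip_power bdd_lip_const lip_free nn)
    qed
    \<comment> \<open>The relation is a linear system for the entries in \<open>T\<close>. Its
      matrix involves only poles, and these lie outside \<open>T\<close>, hence among the free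
      parameters.\<close>
    have lip_T: "bdd_lip E \<delta> (\<lambda>p. fst p s)" if s: "s \<in> T" for s
    proof (rule bdd_lip_linear_solution[where y = "\<lambda>t p. fst p t" and A = "{1..N}" and T = T and B = B and B' = B
          and G = "\<lambda>t n p. snd (snd p) t n" and a = "\<lambda>t n p. mode (\<lambda>c. fst p (fst t, c)) (snd t) n"
          and h = "\<lambda>n p. - (\<Sum>u\<in>S \<times> X - T. fst p u * mode (\<lambda>c. fst p (fst u, c)) (snd u) n)"])
      show "bdd_lip E \<delta> (\<lambda>p. - (\<Sum>u\<in>S \<times> X - T. fst p u * mode (\<lambda>c. fst p (fst u, c)) (snd u) n))" for n
        by (intro bdd_lip_minus bdd_lip_sum bdd_lip_mult lip_free lip_mode nn) (use S in auto)
      show "(\<Sum>t\<in>T. fst p t * mode (\<lambda>c. fst p (fst t, c)) (snd t) n)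
          = - (\<Sum>u\<in>S \<times> X - T. fst p u * mode (\<lambda>c. fst p (fst u, c)) (snd u) n)" if "p \<in> E" "n \<in> {1..N}" for p n
      proof -
        have "finite (S \<times> X)" using S finX by (auto intro: finite_subset)
        then have "(\<Sum>u\<in>S \<times> X. fst p u * mode (\<lambda>c. fst p (fst u, c)) (snd u) n) =
          (\<Sum>u\<in>S \<times> X - T. fst p u * mode (\<lambda>c. fst p (fst u, c)) (snd u) n) + (\<Sum>t\<in>T. fst p t * mode (\<lambda>c. fst p (fst t, c)) (snd t) n)"
          using T by (intro sum.subset_diff) (auto simp: X_def)
        then show ?thesis using EB(6)[OF that] by (simp add: eq_neg_iff_add_eq_0 add.commute)
      qed
    qed (use EB TX s finT nn in \<open>auto intro: lip_mode\<close>)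
    have lip_\<eta>: "bdd_lip E \<delta> (\<lambda>p. fst p u)" if "u \<in> {..R} \<times> X" for u
      using lip_free lip_T that by (cases "u \<in> T") auto
    have "bdd_lip E \<delta> (\<lambda>p. \<phi> p i)" if i: "i \<in> I" for i
    proof (cases "snd i")
      case (Pole f)
      have "bdd_lip E \<delta> (\<lambda>p. fst p i)" using i by (intro lip_\<eta>) (auto simp: I_def)
      then show ?thesis by (cases i) (use Pole in \<open>simp add: \<phi>_def rescale_def\<close>)
    next
      case (Coeff j f)
      have "bdd_lip E \<delta> (\<lambda>p. fst (snd p) (fst i) * fst p i)"
        using i by (intro bdd_lip_mult lip_\<eta> lip_e nn) (auto simp: I_def)
      then show ?thesis by (cases i) (use Coeff in \<open>simp add: \<phi>_def rescale_def\<close>)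
    qed
    then have "\<forall>i\<in>I. \<exists>L\<ge>0. \<forall>p\<in>E. \<forall>q\<in>E. norm (\<phi> p i - \<phi> q i) \<le> L * \<delta> p q"
      by (intro ballI bdd_lip_lipschitz nn)
    then obtain L where L: "\<And>i. i \<in> I \<Longrightarrow> 0 \<le> L i"
      "\<And>i p q. i \<in> I \<Longrightarrow> p \<in> E \<Longrightarrow> q \<in> E \<Longrightarrow> norm (\<phi> p i - \<phi> q i) \<le> L i * \<delta> p q"
      using bchoice[of I "\<lambda>i L. 0 \<le> L \<and> (\<forall>p\<in>E. \<forall>q\<in>E. norm (\<phi> p i - \<phi> q i) \<le> L * \<delta> p q)"] by blast
    have "AE \<zeta> in Pi\<^sub>M I (\<lambda>_. lborel). \<forall>p\<in>E. \<exists>i\<in>I. \<zeta> i \<noteq> \<phi> p i"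
    proof (rule AE_PiM_lower_dim[OF finI finJ cardJ bd])
      show "norm (\<phi> p i - \<phi> q i) \<le> sum L I * (\<Sum>j\<in>J. norm (\<pi> p j - \<pi> q j))"
        if "p \<in> E" "q \<in> E" "i \<in> I" for p q i
      proof -
        have "L i \<le> sum L I" using that L finI by (intro member_le_sum) auto
        then have "L i * \<delta> p q \<le> sum L I * \<delta> p q" using nn by (intro mult_right_mono)
        then show ?thesis using L(2)[OF that(3,1,2)] by (simp add: \<delta>_def)
      qed
    qed
    then show ?thesis
      unfolding param_measure_def X_def[symmetric] I_def[symmetric] E_def[symmetric]
      by eventually_elim (simp add: \<phi>_def case_prod_unfold)
  qed
qed

section \<open>Poles of a source in the span of generic sources\<close>

text \<open>The numbers \<open>w n\<close> are the coefficients of a polynomial whose order exceeds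
  \<open>d f\<close> at each nonzero pole. Dividing out the excess at \<open>x0\<close> leaves order
  \<open>d f0\<close> there; pairing the quotient with the relation then kills every term but the
  top one at \<open>x0\<close>. Coinciding poles elsewhere do no harm, but \<open>x0\<close> itself
  must not be shared.\<close>

lemma annihilated_pole:
  fixes \<eta> :: "nat \<times> coord \<Rightarrow> 'a::real_normed_field" and w :: "nat \<Rightarrow> 'a"
  defines "m u n \<equiv> mode (\<lambda>c. \<eta> (fst u, c)) (snd u) n"
  assumes w: "\<exists>n\<in>{1..N}. w n \<noteq> 0" and S: "finite S" and r0: "r0 \<in> S" and f0: "f0 < F"
    and nz: "\<eta> (r0, Pole f0) \<noteq> 0"
    and ann: "\<And>u. u \<in> S \<times> coords F d \<Longrightarrow> (\<Sum>n\<in>{1..N}. w n * m u n) = 0"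
    and uniq: "\<And>r f. r \<in> S \<Longrightarrow> f < F \<Longrightarrow> \<eta> (r, Pole f) = \<eta> (r0, Pole f0) \<Longrightarrow> r = r0 \<and> f = f0"
    and rel: "\<And>n. n \<in> {1..N} \<Longrightarrow> (\<Sum>u\<in>S \<times> coords F d. \<eta> u * m u n) = 0"
  shows "\<eta> (r0, Coeff (d f0) f0) = 0"
proof -
  define x0 where "x0 = \<eta> (r0, Pole f0)"
  define W where "W = (\<Sum>n\<in>{1..N}. monom (w n) n)"
  have coeff_W: "poly.coeff W n = (if n \<in> {1..N} then w n else 0)" for n
    by (simp add: W_def coeff_sum)
  have W0: "W \<noteq> 0" using w coeff_W by (metis coeff_0)
  have degW: "degree W \<le> N" by (rule degree_le) (auto simp: coeff_W)
  have euler_W: "poly ((euler_op ^^ j) W) (\<eta> (r, Pole f)) = 0" if "r \<in> S" "f < F" "j \<le> d f" for r f j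
  proof -
    have "poly ((euler_op ^^ j) W) (\<eta> (r, Pole f)) = (\<Sum>n\<in>{1..N}. w n * m (r, Coeff j f) n)"
      by (subst poly_euler_op_funpow[OF degW]) (auto simp: coeff_W m_def intro!: sum.cong)
    also have "\<dots> = 0" using that by (intro ann) (auto simp: coords_def)
    finally show ?thesis .
  qed
  have ord_W: "d f < Polynomial.order (\<eta> (r, Pole f)) W" if "r \<in> S" "f < F" "\<eta> (r, Pole f) \<noteq> 0" for r f
    using euler_W[OF that(1,2)] euler_op_funpow_roots_iff[OF W0 that(3)] by blast
  obtain V where V: "W = [:- x0, 1:] ^ Polynomial.order x0 W * V" "\<not> [:- x0, 1:] dvd V"
    using order_decomp[OF W0] by blast
  \<comment> \<open>Lowering the multiplicity of the root \<open>x0\<close> to exactly \<open>d f0\<close> isolates one coefficient.\<close>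
  define W' where "W' = [:- x0, 1:] ^ d f0 * V"
  define k where "k = Polynomial.order x0 W - d f0"
  have "d f0 < Polynomial.order x0 W" using ord_W[OF r0 f0 nz] by (simp add: x0_def)
  then have WW': "W = [:- x0, 1:] ^ k * W'"
    using V(1) by (simp add: W'_def k_def mult.assoc[symmetric] flip: power_add)
  then have W'0: "W' \<noteq> 0" using W0 by auto
  have V0: "V \<noteq> 0" using V(2) by auto
  have "W' dvd W" using WW' by simp
  then have degW': "degree W' \<le> N" using dvd_imp_degree_le W0 degW order_trans by blast
  \<comment> \<open>\<open>W\<close> has no constant term and \<open>x0\<close> is not 0, so
    \<open>W'\<close> has none either.\<close>
  have "poly ([:- x0, 1:] ^ k * W') 0 = 0" using coeff_W[of 0] by (simp add: poly_0_coeff_0 flip: WW')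
  then have "poly W' 0 = 0" using nz by (simp add: poly_power x0_def)
  then have coeff_W'0: "poly.coeff W' 0 = 0" by (simp add: poly_0_coeff_0)
  have ord_x0: "Polynomial.order x0 W' = d f0"
    using W'0 V(2) V0 unfolding W'_def
    by (subst order_mult) (auto simp: order_power_n_n order_eq_0_iff poly_eq_0_iff_dvd)
  have ord_other: "Polynomial.order x W = Polynomial.order x W'" if "x \<noteq> x0" for x
    using W0 that unfolding WW' by (subst order_mult) (auto simp: order_0I poly_power)
  define \<Lambda> where "\<Lambda> u = (\<Sum>n\<in>{1..N}. poly.coeff W' n * m u n)" for u
  have \<Lambda>_Coeff: "\<Lambda> (r, Coeff j f) = poly ((euler_op ^^ j) W') (\<eta> (r, Pole f))" for r j f
    by (subst poly_euler_op_funpow[OF degW' coeff_W'0]) (simp add: \<Lambda>_def m_def)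
  have below: "poly ((euler_op ^^ j) W') x0 = 0" if "j < d f0" for j
    using euler_op_funpow_roots_iff[OF W'0, of x0 j] nz that ord_x0 by (auto simp: x0_def)
  have "\<exists>j\<le>d f0. poly ((euler_op ^^ j) W') x0 \<noteq> 0"
    using euler_op_funpow_roots_iff[OF W'0, of x0 "d f0"] nz ord_x0 by (auto simp: x0_def)
  then have top: "\<Lambda> (r0, Coeff (d f0) f0) \<noteq> 0"
    using below by (metis \<Lambda>_Coeff le_neq_implies_less x0_def)
  have other: "\<Lambda> u = 0" if u: "u \<in> S \<times> coords F d" "u \<noteq> (r0, Coeff (d f0) f0)" for u
  proof -
    obtain r c where rc: "u = (r, c)" "r \<in> S" "c \<in> coords F d" using u by auto
    show ?thesis
    proof (cases c)
      case (Pole f)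
      then show ?thesis by (simp add: \<Lambda>_def m_def rc)
    next
      case (Coeff j f)
      then have jf: "f < F" "j \<le> d f" using rc(3) by (auto simp: coords_def)
      consider "\<eta> (r, Pole f) = 0" | "\<eta> (r, Pole f) = x0" | "\<eta> (r, Pole f) \<noteq> 0" "\<eta> (r, Pole f) \<noteq> x0" by blast
      then show ?thesis
      proof cases
        \<comment> \<open>All modes at the pole 0 vanish, since the samples start at
          \<open>n = 1\<close>.\<close>
        case 1
        then show ?thesis by (auto simp: \<Lambda>_def m_def rc Coeff intro!: sum.neutral)
      next
        case 2
        then have eq: "r = r0" "f = f0" using uniq[OF rc(2) jf(1)] by (auto simp: x0_def)
        then have "j < d f0" using jf u(2) rc Coeff by auto
        then show ?thesis using below 2 by (simp add: rc Coeff \<Lambda>_Coeff)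
      next
        case 3
        then have "d f < Polynomial.order (\<eta> (r, Pole f)) W'" using ord_W[OF rc(2) jf(1)] ord_other by simp
        then show ?thesis using euler_op_funpow_roots_iff[OF W'0 3(1), of "d f"] jf
          by (simp add: rc Coeff \<Lambda>_Coeff)
      qed
    qed
  qed
  have "0 = (\<Sum>n\<in>{1..N}. poly.coeff W' n * (\<Sum>u\<in>S \<times> coords F d. \<eta> u * m u n))"
    by (simp add: rel)
  also have "\<dots> = (\<Sum>u\<in>S \<times> coords F d. \<eta> u * \<Lambda> u)"
    unfolding sum_distrib_left \<Lambda>_def by (subst sum.swap) (simp add: mult_ac)
  also have "\<dots> = (\<Sum>u\<in>S \<times> coords F d. if u = (r0, Coeff (d f0) f0) then \<eta> u * \<Lambda> u else 0)"
    by (intro sum.cong refl) (auto simp: other)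
  also have "\<dots> = \<eta> (r0, Coeff (d f0) f0) * \<Lambda> (r0, Coeff (d f0) f0)"
    using S r0 f0 finite_coords[of F d] by (auto simp: coords_def)
  finally show ?thesis using top by auto
qed

text \<open>The source \<open>z\<close> is arbitrary and may have zero or repeated poles. Together
  with distinct nonzero parameters, this is all that recovery uses of genericity.\<close>

definition pole_matching :: "nat \<Rightarrow> nat \<Rightarrow> nat \<Rightarrow> (nat \<Rightarrow> nat) \<Rightarrow> (nat \<times> coord \<Rightarrow> 'a::comm_ring_1) \<Rightarrow> bool" where
  "pole_matching N R F d \<zeta> \<longleftrightarrow> (\<forall>c z.
     (\<forall>n\<in>{1..N}. (\<Sum>r<R. c r * source F d (\<lambda>x. \<zeta> (r, x)) n) = source F d z n) \<longrightarrow>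
     (\<forall>r<R. c r \<noteq> 0 \<longrightarrow> (\<forall>f<F. \<exists>f'<F. z (Pole f') = \<zeta> (r, Pole f))))"

text \<open>A violating combination, divided by the nonzero scalar \<open>c r0\<close>, becomes a
  relation. If its modes contain a dual basis, \<open>avoid\<close> excludes it; otherwise
  \<open>annihilated_pole\<close> makes the top coefficient at the unmatched pole vanish, against
  \<open>nz\<close>.\<close>

lemma pole_matchingI:
  fixes \<zeta> :: "nat \<times> coord \<Rightarrow> 'a::real_normed_field"
  assumes inj: "inj_on \<zeta> ({..<R} \<times> coords F d)" and nz: "\<And>i. i \<in> {..<R} \<times> coords F d \<Longrightarrow> \<zeta> i \<noteq> 0"
    and avoid: "\<And>S T r0 B \<eta> e G. S \<subseteq> {..R} \<Longrightarrow> T \<subseteq> S \<times> coords F d \<Longrightarrow> card T = N \<Longrightarrow> r0 < R \<Longrightarrow>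
       (\<eta>, e, G) \<in> relations N R F d S r0 T (real B) \<Longrightarrow>
       \<exists>(r, c) \<in> {..<R} \<times> coords F d. \<zeta> (r, c) \<noteq> rescale (e r) (\<lambda>c. \<eta> (r, c)) c"
  shows "pole_matching N R F d \<zeta>"
  unfolding pole_matching_def
proof (intro allI impI)
  fix c z r0 f0
  assume rel0: "\<forall>n\<in>{1..N}. (\<Sum>r<R. c r * source F d (\<lambda>x. \<zeta> (r, x)) n) = source F d z n"
    and r0: "r0 < R" "c r0 \<noteq> 0" and f0: "f0 < F"
  show "\<exists>f'<F. z (Pole f') = \<zeta> (r0, Pole f0)"
  proof (rule ccontr)
    assume contra: "\<not> ?thesis"
    define P where "P = {r. r < R \<and> c r \<noteq> 0}"
    define S where "S = insert R P"
    \<comment> \<open>Dividing by \<open>c r0\<close> normalises \<open>e r0\<close> to 1, which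
      saves one parameter in the count.\<close>
    define \<kappa> where "\<kappa> r = (if r = R then - 1 / c r0 else if r \<in> P then c r / c r0 else 1)" for r
    define \<eta> where "\<eta> = (\<lambda>(r, x). rescale (\<kappa> r) (if r = R then z else (\<lambda>x. \<zeta> (r, x))) x)"
    define e where "e r = (if r \<in> P then c r0 / c r else 1)" for r
    define m where "m u n = mode (\<lambda>c. \<eta> (fst u, c)) (snd u) n" for u n
    have finP: "finite P" and finS: "finite S" by (auto simp: P_def S_def)
    have SR: "S \<subseteq> {..R}" by (auto simp: P_def S_def)
    have \<eta>_row: "(\<lambda>x. \<eta> (r, x)) = rescale (\<kappa> r) (if r = R then z else (\<lambda>x. \<zeta> (r, x)))" for r
      by (auto simp: \<eta>_def)
    have pole: "\<eta> (r, Pole f) = (if r = R then z (Pole f) else \<zeta> (r, Pole f))" for r f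
      by (simp add: \<eta>_def rescale_def)
    have rel: "(\<Sum>u\<in>S \<times> coords F d. \<eta> u * m u n) = 0" if n: "n \<in> {1..N}" for n
    proof -
      have "(\<Sum>u\<in>S \<times> coords F d. \<eta> u * m u n) = (\<Sum>r\<in>S. source F d (\<lambda>x. \<eta> (r, x)) n)"
        by (simp add: source_eq_sum_modes m_def sum.cartesian_product case_prod_unfold)
      also have "\<dots> = (\<Sum>r\<in>S. \<kappa> r * source F d (if r = R then z else (\<lambda>x. \<zeta> (r, x))) n)"
        by (simp only: \<eta>_row source_rescale)
      also have "\<dots> = - source F d z n / c r0 + (\<Sum>r\<in>P. c r * source F d (\<lambda>x. \<zeta> (r, x)) n) / c r0"
        unfolding S_def sum_divide_distrib using finP
        by (subst sum.insert) (auto simp: P_def \<kappa>_def intro!: sum.cong)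
      also have "(\<Sum>r\<in>P. c r * source F d (\<lambda>x. \<zeta> (r, x)) n) = (\<Sum>r<R. c r * source F d (\<lambda>x. \<zeta> (r, x)) n)"
        by (intro sum.mono_neutral_left) (auto simp: P_def)
      finally show ?thesis using rel0 n by simp
    qed
    have restore: "rescale (e r) (\<lambda>x. \<eta> (r, x)) x = \<zeta> (r, x)" if "r < R" for r x
      using that r0 by (auto simp: \<eta>_def rescale_def e_def \<kappa>_def P_def split: coord.split)
    consider (annihilator) w where "\<exists>n\<in>{1..N}. w n \<noteq> 0"
        and "\<And>u. u \<in> S \<times> coords F d \<Longrightarrow> (\<Sum>n\<in>{1..N}. w n * m u n) = 0"
      | (dual) T G where "T \<subseteq> S \<times> coords F d" and "card T = N"
        and "\<And>s t. s \<in> T \<Longrightarrow> t \<in> T \<Longrightarrow> (\<Sum>n\<in>{1..N}. G s n * m t n) = (if s = t then 1 else 0)"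
    proof (rule dual_basis_or_annihilator[OF finite_cartesian_product[OF finS finite_coords[of F d]] finite_atLeastAtMost[of 1 N], of m], goal_cases)
      case (1 w)
      show ?thesis by (rule 1(1)[OF 1(3,4)])
    next
      case (2 T G)
      show ?thesis by (rule 2(2)[of T G]) (use 2(3-5) in simp_all)
    qed
    then show False
    proof cases
      case (annihilator w)
      have "\<eta> (r0, Coeff (d f0) f0) = 0"
      proof (rule annihilated_pole[where S = S and F = F and N = N and w = w])
        show "\<eta> (r0, Pole f0) \<noteq> 0" using nz[of "(r0, Pole f0)"] r0 f0 by (auto simp: pole coords_def)
        show "r = r0 \<and> f = f0" if "r \<in> S" "f < F" "\<eta> (r, Pole f) = \<eta> (r0, Pole f0)" for r f
        proof (cases "r = R")
          case True
          \<comment> \<open>Row \<open>R\<close> holds the poles of \<open>z\<close>, none of which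
            equals the unmatched pole.\<close>
          then show ?thesis using that contra r0 by (auto simp: pole)
        next
          case False
          then have "r < R" using that SR by force
          then have "\<zeta> (r, Pole f) = \<zeta> (r0, Pole f0)" using that r0 by (simp add: pole)
          then show ?thesis using inj_onD[OF inj, of "(r, Pole f)" "(r0, Pole f0)"] \<open>r < R\<close> r0 f0 that
            by (auto simp: coords_def)
        qed
      qed (use annihilator rel finS r0 f0 in \<open>auto simp: m_def S_def P_def\<close>)
      then show ?thesis
        using restore[OF r0(1), of "Coeff (d f0) f0"] nz[of "(r0, Coeff (d f0) f0)"] r0 f0
        by (auto simp: rescale_def coords_def)
    next
      case (dual T G)
      have finT: "finite T" using dual(1) finS finite_coords finite_subset by blast
      define b where "b = (\<Sum>u\<in>{..R} \<times> coords F d. norm (\<eta> u)) + (\<Sum>r<R. norm (e r)) + (\<Sum>t\<in>T. \<Sum>n\<in>{1..N}. norm (G t n))"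
      \<comment> \<open>A natural number as bound, so that countably many null sets suffice.\<close>
      obtain B :: nat where B: "b \<le> real B" using real_arch_simple by blast
      have nn: "0 \<le> (\<Sum>u\<in>{..R} \<times> coords F d. norm (\<eta> u))" "0 \<le> (\<Sum>r<R. norm (e r))" "0 \<le> (\<Sum>t\<in>T. \<Sum>n\<in>{1..N}. norm (G t n))"
        by (auto intro!: sum_nonneg)
      have "norm (\<eta> u) \<le> real B" if "u \<in> {..R} \<times> coords F d" for u
        using member_le_sum[OF that, of "\<lambda>u. norm (\<eta> u)"] finite_coords[of F d] B nn by (simp add: b_def)
      moreover have "norm (e r) \<le> real B" if "r < R" for r
        using member_le_sum[of r "{..<R}" "\<lambda>r. norm (e r)"] that B nn by (simp add: b_def)
      moreover have "norm (G t n) \<le> real B" if "t \<in> T" "n \<in> {1..N}" for t n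
      proof -
        have "norm (G t n) \<le> (\<Sum>n\<in>{1..N}. norm (G t n))"
          using member_le_sum[OF that(2), of "\<lambda>n. norm (G t n)"] by simp
        also have "\<dots> \<le> (\<Sum>t\<in>T. \<Sum>n\<in>{1..N}. norm (G t n))"
          using member_le_sum[OF that(1), of "\<lambda>t. \<Sum>n\<in>{1..N}. norm (G t n)"] finT by (simp add: sum_nonneg)
        finally show ?thesis using B nn by (simp add: b_def)
      qed
      moreover have "e r0 = 1" using r0 by (simp add: e_def)
      ultimately have "(\<eta>, e, G) \<in> relations N R F d S r0 T (real B)"
        using dual(3) rel by (auto simp: relations_def m_def)
      from avoid[OF SR dual(1) _ r0(1) this] dual(2) restore show ?thesis by auto
    qed
  qed
qed

section \<open>Almost sure properties of the parameters\<close>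

lemma AE_coordinates:
  assumes I: "finite I"
  shows "AE \<zeta> in Pi\<^sub>M I (\<lambda>_. lborel :: 'a::euclidean_space measure). \<forall>i\<in>I. \<zeta> i \<noteq> 0 \<and> (\<forall>j\<in>I. i \<noteq> j \<longrightarrow> \<zeta> i \<noteq> \<zeta> j)"
proof -
  \<comment> \<open>Each exceptional set is a graph over the coordinates other than
    \<open>i\<close>, with \<open>h\<close> either 0 or another coordinate. The graph is cut off at
    norm \<open>B\<close> to have bounded parameters, and then exhausted by letting \<open>B\<close>
    run through the naturals.\<close>
  have *: "AE \<zeta> in Pi\<^sub>M I (\<lambda>_. lborel :: 'a measure). \<zeta> i \<noteq> h \<zeta>"
    if i: "i \<in> I" and h: "\<And>\<zeta> \<xi>. norm (h \<zeta> - h \<xi> :: 'a) \<le> (\<Sum>j\<in>I - {i}. norm (\<zeta> j - \<xi> j))" for i and h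
  proof -
    have "AE \<zeta> in Pi\<^sub>M I (\<lambda>_. lborel). \<forall>\<xi>\<in>{\<xi>. (\<forall>j\<in>I. norm (\<xi> j) \<le> real B) \<and> \<xi> i = h \<xi>}. \<exists>j\<in>I. \<zeta> j \<noteq> \<xi> j" for B :: nat
    proof (rule AE_PiM_lower_dim[where J = "I - {i}" and \<pi> = "\<lambda>\<xi>. \<xi>" and L = 1])
      show "card (I - {i}) < card I" using I i by (rule card_Diff1_less)
      fix \<zeta> \<xi> :: "'b \<Rightarrow> 'a" and j
      assume "\<zeta> \<in> {\<xi>. (\<forall>j\<in>I. norm (\<xi> j) \<le> real B) \<and> \<xi> i = h \<xi>}" "\<xi> \<in> {\<xi>. (\<forall>j\<in>I. norm (\<xi> j) \<le> real B) \<and> \<xi> i = h \<xi>}" "j \<in> I"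
      then show "norm (\<zeta> j - \<xi> j) \<le> 1 * (\<Sum>j\<in>I - {i}. norm (\<zeta> j - \<xi> j))"
        using h[of \<zeta> \<xi>] member_le_sum[of j "I - {i}" "\<lambda>j. norm (\<zeta> j - \<xi> j)"] I by (cases "j = i") auto
    qed (use I in auto)
    then have "AE \<zeta> in Pi\<^sub>M I (\<lambda>_. lborel). \<forall>B::nat. \<forall>\<xi>\<in>{\<xi>. (\<forall>j\<in>I. norm (\<xi> j) \<le> real B) \<and> \<xi> i = h \<xi>}. \<exists>j\<in>I. \<zeta> j \<noteq> \<xi> j"
      by (simp add: AE_all_countable)
    then show ?thesis
    proof (rule AE_mp, intro AE_I2 impI notI)
      fix \<zeta> assume A: "\<forall>B::nat. \<forall>\<xi>\<in>{\<xi>. (\<forall>j\<in>I. norm (\<xi> j) \<le> real B) \<and> \<xi> i = h \<xi>}. \<exists>j\<in>I. \<zeta> j \<noteq> \<xi> j" "\<zeta> i = h \<zeta>"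
      obtain B :: nat where "(\<Sum>j\<in>I. norm (\<zeta> j)) \<le> real B" using real_arch_simple by blast
      then have "\<forall>j\<in>I. norm (\<zeta> j) \<le> real B"
        using member_le_sum[of _ I "\<lambda>j. norm (\<zeta> j)"] I by (meson norm_ge_zero order_trans)
      then show False using A by blast
    qed
  qed
  have "AE \<zeta> in Pi\<^sub>M I (\<lambda>_. lborel :: 'a measure). \<zeta> i \<noteq> 0" if "i \<in> I" for i
    by (rule *[OF that]) (auto intro: sum_nonneg)
  moreover have "AE \<zeta> in Pi\<^sub>M I (\<lambda>_. lborel :: 'a measure). \<zeta> i \<noteq> \<zeta> j" if "i \<in> I" "j \<in> I" "i \<noteq> j" for i j
    by (rule *[OF that(1)]) (use that I member_le_sum[of j "I - {i}" "\<lambda>j. norm (_ j - _ j)"] in auto)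
  ultimately show ?thesis
    using I by (simp add: AE_ball_countable countable_finite AE_impI)
qed

text \<open>The exceptional parameters lie in a countable union of null sets: finitely many
  \<open>S\<close>, \<open>T\<close> and \<open>r0\<close>, and a natural bound
  \<open>B\<close>.\<close>

lemma AE_pole_matching:
  assumes "R + card (coords F d) \<le> N"
  shows "AE \<zeta> in (param_measure R F d :: (nat \<times> coord \<Rightarrow> 'a::{real_normed_field,euclidean_space}) measure).
    pole_matching N R F d \<zeta> \<and> inj_on \<zeta> ({..<R} \<times> coords F d) \<and> (\<forall>i\<in>{..<R} \<times> coords F d. \<zeta> i \<noteq> 0)"
proof -
  define Q where "Q = (SIGMA S:Pow {..R}. {T. T \<subseteq> S \<times> coords F d \<and> card T = N})"
  have "finite Q" unfolding Q_def
  proof (intro finite_SigmaI)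
    fix S assume "S \<in> Pow {..R}"
    then have "finite (S \<times> coords F d)" using finite_coords finite_subset by blast
    then show "finite {T. T \<subseteq> S \<times> coords F d \<and> card T = N}"
      by (rule finite_subset[rotated, OF finite_Pow_iff[THEN iffD2]]) auto
  qed auto
  then have cQ: "countable Q" by (rule countable_finite)
  have "AE \<zeta> in (param_measure R F d :: (nat \<times> coord \<Rightarrow> 'a) measure).
    \<forall>q\<in>Q. \<forall>r0\<in>{..<R}. \<forall>B::nat. \<forall>(\<eta>, e, G) \<in> relations N R F d (fst q) r0 (snd q) (real B).
      \<exists>(r, c) \<in> {..<R} \<times> coords F d. \<zeta> (r, c) \<noteq> rescale (e r) (\<lambda>c. \<eta> (r, c)) c"
    unfolding AE_ball_countable[OF cQ] AE_ball_countable[OF countable_finite[OF finite_lessThan]] AE_all_countable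
    by (intro ballI allI AE_no_relation assms) (auto simp: Q_def)
  moreover have "AE \<zeta> in (param_measure R F d :: (nat \<times> coord \<Rightarrow> 'a) measure).
    \<forall>i\<in>{..<R} \<times> coords F d. \<zeta> i \<noteq> 0 \<and> (\<forall>j\<in>{..<R} \<times> coords F d. i \<noteq> j \<longrightarrow> \<zeta> i \<noteq> \<zeta> j)"
    unfolding param_measure_def by (rule AE_coordinates) (simp add: finite_coords)
  ultimately show ?thesis
  proof eventually_elim
    case (elim \<zeta>)
    have inj: "inj_on \<zeta> ({..<R} \<times> coords F d)" using elim(2) by (meson inj_onI)
    moreover have nz: "\<forall>i\<in>{..<R} \<times> coords F d. \<zeta> i \<noteq> 0" using elim(2) by blast
    moreover have "pole_matching N R F d \<zeta>"
    proof (rule pole_matchingI[OF inj])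
      fix S T r0 B and \<eta> :: "nat \<times> coord \<Rightarrow> 'a" and e G
      assume *: "S \<subseteq> {..R}" "T \<subseteq> S \<times> coords F d" "card T = N" "r0 < R"
        "(\<eta>, e, G) \<in> relations N R F d S r0 T (real B)"
      then have "(S, T) \<in> Q" by (auto simp: Q_def)
      then show "\<exists>(r, c) \<in> {..<R} \<times> coords F d. \<zeta> (r, c) \<noteq> rescale (e r) (\<lambda>c. \<eta> (r, c)) c"
        using bspec[OF elim(1)] *(4,5) by fastforce
    qed (use nz in blast)
    ultimately show ?case by blast
  qed
qed

section \<open>Recovery from matching poles\<close>

text \<open>A dual family for all columns is a left inverse. A column left out by the family would
  be a combination of the others and yield a nonzero kernel vector.\<close>

lemma ex_left_inverse_mat:
  fixes A :: "'a::field Matrix.mat"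
  assumes A: "A \<in> carrier_mat n R"
    and inj: "\<And>v. v \<in> carrier_vec R \<Longrightarrow> A *\<^sub>v v = 0\<^sub>v n \<Longrightarrow> v = 0\<^sub>v R"
  obtains L where "L \<in> carrier_mat R n" "L * A = 1\<^sub>m R"
proof -
  obtain T G where T: "T \<subseteq> {..<R}"
    and G: "\<And>s t. s \<in> T \<Longrightarrow> t \<in> T \<Longrightarrow> (\<Sum>i\<in>{..<n}. G s i * A $$ (i, t)) = (if s = t then 1 else 0)"
    and span: "\<And>u i. u \<in> {..<R} \<Longrightarrow> i \<in> {..<n} \<Longrightarrow>
      A $$ (i, u) = (\<Sum>t\<in>T. (\<Sum>m\<in>{..<n}. G t m * A $$ (m, u)) * A $$ (i, t))"
    using dual_family[of "{..<R}" "{..<n}" "\<lambda>r i. A $$ (i, r)"] by auto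
  have "T = {..<R}"
  proof (rule ccontr)
    assume "T \<noteq> {..<R}"
    then obtain u where u: "u < R" "u \<notin> T" using T by auto
    define a where "a t = (if t = u then - 1 else if t \<in> T then \<Sum>m\<in>{..<n}. G t m * A $$ (m, u) else 0)" for t
    have "A *\<^sub>v Matrix.vec R a = 0\<^sub>v n"
    proof (rule eq_vecI)
      fix i assume "i < dim_vec (0\<^sub>v n :: 'a Matrix.vec)"
      then have i: "i < n" by simp
      have "(A *\<^sub>v Matrix.vec R a) $ i = (\<Sum>t\<in>{..<R}. A $$ (i, t) * a t)"
        using A i by (simp add: scalar_prod_def lessThan_atLeast0)
      also have "\<dots> = (\<Sum>t\<in>insert u T. A $$ (i, t) * a t)"
        using T u by (intro sum.mono_neutral_right) (auto simp: a_def)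
      also have "\<dots> = - A $$ (i, u) + (\<Sum>t\<in>T. A $$ (i, t) * a t)"
        using T u by (subst sum.insert) (auto simp: a_def intro: finite_subset)
      also have "(\<Sum>t\<in>T. A $$ (i, t) * a t) = A $$ (i, u)"
        using span[of u i] u i by (auto simp: a_def mult.commute intro!: sum.cong)
      finally show "(A *\<^sub>v Matrix.vec R a) $ i = (0\<^sub>v n) $ i" using i by simp
    qed (use A in simp)
    then have "Matrix.vec R a = 0\<^sub>v R" by (intro inj) auto
    then have "Matrix.vec R a $ u = 0\<^sub>v R $ u" by simp
    then show False using u by (simp add: a_def)
  qed
  then have "Matrix.mat R n (\<lambda>(r, i). G r i) * A = 1\<^sub>m R"
    using G A by (intro eq_matI) (auto simp: scalar_prod_def lessThan_atLeast0)
  then show thesis by (intro that[of "Matrix.mat R n (\<lambda>(r, i). G r i)"]) auto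
qed

text \<open>Independence of the set of columns ignores repetitions, so the rank is first used to
  show that the \<open>R\<close> columns are distinct.\<close>

lemma ex_left_inverse_full_column_rank:
  fixes M :: "'a::field Matrix.mat"
  assumes M: "M \<in> carrier_mat K R" and rank: "vec_space.rank K M = R"
  obtains L where "L \<in> carrier_mat R K" "L * M = 1\<^sub>m R"
proof (rule ex_left_inverse_mat[OF M])
  fix v :: "'a Matrix.vec" assume v: "v \<in> carrier_vec R" "M *\<^sub>v v = 0\<^sub>v K"
  interpret vec_space "TYPE('a)" K .
  obtain U where U: "maximal U (\<lambda>T. T \<subseteq> set (cols M) \<and> lin_indpt T)"
    using maximal_exists_superset[of "set (cols M)" "\<lambda>T. T \<subseteq> set (cols M) \<and> lin_indpt T" "{}"]
    by (auto simp: lin_dep_def)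
  then have "R \<le> card (set (cols M))"
    using rank_card_indpt[OF M U] rank by (auto simp: maximal_def intro: card_mono)
  then have dist: "distinct (cols M)"
    using M card_length[of "cols M"] by (intro card_distinct) auto
  show "v = 0\<^sub>v R"
    using lin_depI[OF M v(1) _ v(2) dist] full_rank_lin_indpt[OF M rank dist] by blast
qed

text \<open>An invertible matrix relates the two factorizations: \<open>S' = S * D\<close> and
  \<open>M = M' * transpose_mat D\<close>. Pole matching allows only one nonzero entry per column of
  \<open>D\<close>, so \<open>D\<close> is a permutation matrix up to scaling, and the scale factors
  cancel in the rank-one terms.\<close>

lemma unique_recovery:
  fixes M :: "'a::real_normed_field Matrix.mat"
  assumes F: "0 < F" and M: "M \<in> carrier_mat K R" and rank: "vec_space.rank K M = R"
    and match: "pole_matching N R F d \<zeta>"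
    and inj: "inj_on \<zeta> ({..<R} \<times> coords F d)" and nz: "\<forall>i\<in>{..<R} \<times> coords F d. \<zeta> i \<noteq> 0"
  shows "uniquely_recovered K N R F d M (source_mat N R F d \<zeta>)"
proof -
  define S where "S = source_mat N R F d \<zeta>"
  have S: "S \<in> carrier_mat N R" unfolding S_def source_mat_def by (rule carrier_matI) auto
  have S_index: "S $$ (i, r) = source F d (\<lambda>x. \<zeta> (r, x)) (i + 1)" if "i < N" "r < R" for i r
    using that by (simp add: S_def source_mat_def mat_of_cols_index source_vec_def)
  have matching: "\<exists>f'<F. z (Pole f') = \<zeta> (r, Pole f)"
    if Sv: "\<And>i. i < N \<Longrightarrow> (S *\<^sub>v v) $ i = source F d z (i + 1)" and v: "v \<in> carrier_vec R" and r: "r < R" "v $ r \<noteq> 0" "f < F" for v z r f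
  proof -
    have "(\<Sum>r<R. v $ r * source F d (\<lambda>x. \<zeta> (r, x)) n) = source F d z n" if n: "n \<in> {1..N}" for n
    proof -
      have "n - 1 < N" using n by auto
      then have "(S *\<^sub>v v) $ (n - 1) = (\<Sum>r<R. v $ r * source F d (\<lambda>x. \<zeta> (r, x)) (n - 1 + 1))"
        using S v
        by (auto simp: scalar_prod_def lessThan_atLeast0 S_index mult.commute intro!: sum.cong)
      then show ?thesis using Sv[OF \<open>n - 1 < N\<close>] n by simp
    qed
    then show ?thesis using match r unfolding pole_matching_def by blast
  qed
  obtain LM where LM: "LM \<in> carrier_mat R K" "LM * M = 1\<^sub>m R"
    using ex_left_inverse_full_column_rank[OF M rank] .
  \<comment> \<open>A vanishing combination of the columns of \<open>S\<close> equals the source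
    with all parameters 0; matching would then make 0 a pole of a given source.\<close>
  obtain LS where LS: "LS \<in> carrier_mat R N" "LS * S = 1\<^sub>m R"
  proof (rule ex_left_inverse_mat[OF S])
    fix v :: "'a Matrix.vec" assume v: "v \<in> carrier_vec R" "S *\<^sub>v v = 0\<^sub>v N"
    show "v = 0\<^sub>v R"
    proof (rule eq_vecI)
      fix r assume "r < dim_vec (0\<^sub>v R :: 'a Matrix.vec)"
      then have r: "r < R" by simp
      have "\<zeta> (r, Pole 0) \<noteq> 0" using nz r F by (simp add: coords_def)
      moreover have "\<exists>f'<F. (0::'a) = \<zeta> (r, Pole 0)" if "v $ r \<noteq> 0"
        by (rule matching[of v "\<lambda>_. 0" r 0]) (use v r F that in \<open>simp_all add: source_def\<close>)
      ultimately show "v $ r = 0\<^sub>v R $ r" using r by auto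
    qed (use v in auto)
  qed
  show ?thesis
    unfolding uniquely_recovered_def S_def[symmetric]
  proof (intro ballI impI)
    fix M' S' assume M': "M' \<in> carrier_mat K R" and S': "S' \<in> carrier_mat N R"
      and cols: "\<forall>r<R. \<exists>z. col S' r = source_vec N F d z"
      and eq: "M * transpose_mat S = M' * transpose_mat S'"
    define C where "C = transpose_mat (LM * M')"
    define D where "D = LS * S'"
    have C: "C \<in> carrier_mat R R" using LM M' by (simp add: C_def)
    have D: "D \<in> carrier_mat R R" using LS S' by (simp add: D_def)
    have "transpose_mat S = LM * (M * transpose_mat S)"
      using LM M S by (simp flip: assoc_mult_mat[of LM R K M R "transpose_mat S" N])
    also have "\<dots> = (LM * M') * transpose_mat S'"
      using LM M' S' unfolding eq by (simp add: assoc_mult_mat[of LM R K M' R "transpose_mat S'" N])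
    finally have St: "transpose_mat S = (LM * M') * transpose_mat S'" .
    have "S = transpose_mat (transpose_mat S)" by simp
    also have "\<dots> = S' * C"
      unfolding St C_def using LM M' S' by (subst transpose_mult[of _ R R _ N]) auto
    finally have SC: "S = S' * C" .
     have "D * C = 1\<^sub>m R" using SC LS S' C by (simp add: D_def assoc_mult_mat[of LS R N S' R C R])
    \<comment> \<open>A left inverse of a square matrix is also a right inverse.\<close>
    then have CD: "C * D = 1\<^sub>m R" using mat_mult_left_right_inverse[OF D C] by simp
    have SD: "S' = S * D" using S' C D CD by (simp add: SC assoc_mult_mat[of S' N R C R D R])
    have "M = M * transpose_mat (LS * S)" unfolding LS(2) using M by simp
    also have "\<dots> = (M * transpose_mat S) * transpose_mat LS"
      using LS S M by (subst transpose_mult[of LS R N S R]) (simp_all add: assoc_mult_mat[of M K R "transpose_mat S" N "transpose_mat LS" R])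
    also have "\<dots> = M' * transpose_mat (LS * S')"
      using LS S' M' unfolding eq by (simp add: transpose_mult[of LS R N S' R] assoc_mult_mat[of M' K R "transpose_mat S'" N "transpose_mat LS" R])
    finally have MD: "M = M' * transpose_mat D" by (simp add: D_def)
    \<comment> \<open>Two nonzero entries in column \<open>j\<close> would force
      \<open>2 * F\<close> distinct poles into the \<open>F\<close> poles of a single
      source.\<close>
    have D_unique: "r1 = r2" if "j < R" "r1 < R" "r2 < R" "D $$ (r1, j) \<noteq> 0" "D $$ (r2, j) \<noteq> 0" for j r1 r2
    proof (rule ccontr)
      assume ne: "r1 \<noteq> r2"
      obtain z where z: "col S' j = source_vec N F d z" using cols \<open>j < R\<close> by blast
      have Sz: "(S *\<^sub>v col D j) $ i = source F d z (i + 1)" if "i < N" for i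
      proof -
        have "S *\<^sub>v col D j = col S' j" unfolding SD using col_mult2[OF S D \<open>j < R\<close>] by simp
        then show ?thesis using z that by (simp add: source_vec_def)
      qed
      have incl: "(\<lambda>f. \<zeta> (r, Pole f)) ` {..<F} \<subseteq> (\<lambda>f. z (Pole f)) ` {..<F}" if "r < R" "D $$ (r, j) \<noteq> 0" for r
      proof (intro image_subsetI)
        fix f assume "f \<in> {..<F}"
        then have "\<exists>f'<F. z (Pole f') = \<zeta> (r, Pole f)"
          using that D \<open>j < R\<close> by (intro matching[OF Sz]) auto
        then show "\<zeta> (r, Pole f) \<in> (\<lambda>f. z (Pole f)) ` {..<F}" by force
      qed
      have inj': "inj_on (\<lambda>(r, f). \<zeta> (r, Pole f)) ({r1, r2} \<times> {..<F})"
      proof (rule inj_onI, clarify)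
        fix r f r' f' assume "r \<in> {r1, r2}" "r' \<in> {r1, r2}" "f < F" "f' < F" "\<zeta> (r, Pole f) = \<zeta> (r', Pole f')"
        then show "r = r' \<and> f = f'"
          using inj_onD[OF inj, of "(r, Pole f)" "(r', Pole f')"] that by (auto simp: coords_def)
      qed
      have "2 * F = card ((\<lambda>(r, f). \<zeta> (r, Pole f)) ` ({r1, r2} \<times> {..<F}))"
        using card_image[OF inj'] ne by (simp add: card_cartesian_product)
      also have "\<dots> \<le> card ((\<lambda>f. z (Pole f)) ` {..<F})"
        using incl[OF that(2,4)] incl[OF that(3,5)] by (intro card_mono) auto
      also have "\<dots> \<le> F" using card_image_le[of "{..<F}"] by simp
      finally show False using F by simp
    qed
    have D_ex: "\<exists>r<R. D $$ (r, j) \<noteq> 0" if j: "j < R" for j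
    proof (rule ccontr)
      assume "\<not> ?thesis"
      then have "(C * D) $$ (j, j) = 0" using C D j by (auto simp: scalar_prod_def intro!: sum.neutral)
      then show False using CD j by simp
    qed
    have "\<forall>j. \<exists>r. j < R \<longrightarrow> r < R \<and> D $$ (r, j) \<noteq> 0" using D_ex by blast
    then obtain s where s: "\<And>j. j < R \<Longrightarrow> s j < R" "\<And>j. j < R \<Longrightarrow> D $$ (s j, j) \<noteq> 0" by metis
    have s_zero: "D $$ (r, j) = 0" if "j < R" "r < R" "r \<noteq> s j" for r j
      using D_unique that s by blast
    \<comment> \<open>A row of \<open>D\<close> outside the image of \<open>s\<close> would be zero,
      which contradicts the invertibility of \<open>D\<close>.\<close>
    have surj: "\<exists>j<R. r = s j" if r: "r < R" for r
    proof (rule ccontr)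
      assume "\<not> ?thesis"
      then have "(D * C) $$ (r, r) = 0" using C D r s_zero by (auto simp: scalar_prod_def intro!: sum.neutral)
      then show False using \<open>D * C = 1\<^sub>m R\<close> r by simp
    qed
    have "{..<R} \<subseteq> s ` {..<R}"
    proof
      fix r assume "r \<in> {..<R}"
      then show "r \<in> s ` {..<R}" using surj[of r] by auto
    qed
    then have "s ` {..<R} = {..<R}" using s(1) by auto
    then have inj_s: "inj_on s {..<R}" by (simp add: eq_card_imp_inj_on)
    define \<sigma> where "\<sigma> j = (if j < R then s j else j)" for j
    have "bij_betw \<sigma> {..<R} {..<R}"
      using inj_s \<open>s ` {..<R} = {..<R}\<close> by (auto simp: bij_betw_def \<sigma>_def inj_on_def)
    then have perm: "\<sigma> permutes {..<R}" by (intro bij_imp_permutes) (auto simp: \<sigma>_def)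
    have S'_index: "S' $$ (i, j) = S $$ (i, s j) * D $$ (s j, j)" if "i < N" "j < R" for i j
    proof -
      have "S' $$ (i, j) = (\<Sum>r<R. S $$ (i, r) * D $$ (r, j))"
        using S D that unfolding SD by (simp add: scalar_prod_def lessThan_atLeast0)
      also have "\<dots> = (\<Sum>r<R. if r = s j then S $$ (i, r) * D $$ (r, j) else 0)"
        using s_zero that by (intro sum.cong) auto
      finally show ?thesis using s that by simp
    qed
    \<comment> \<open>As \<open>s\<close> is injective, each row of \<open>D\<close> also has a
      single nonzero entry.\<close>
    have M_index: "M $$ (i, s j) = M' $$ (i, j) * D $$ (s j, j)" if "i < K" "j < R" for i j
    proof -
      have "M $$ (i, s j) = (\<Sum>k<R. M' $$ (i, k) * D $$ (s j, k))"
        using M' D that s by (subst MD) (simp add: scalar_prod_def lessThan_atLeast0)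
      also have "\<dots> = (\<Sum>k<R. if k = j then M' $$ (i, k) * D $$ (s j, k) else 0)"
      proof (intro sum.cong refl)
        fix k assume "k \<in> {..<R}"
        then show "M' $$ (i, k) * D $$ (s j, k) = (if k = j then M' $$ (i, k) * D $$ (s j, k) else 0)"
          using s_zero[of k "s j"] s that inj_onD[OF inj_s, of j k] by auto
      qed
      finally show ?thesis using that by simp
    qed
    \<comment> \<open>The scalar \<open>D $$ (s r, r)\<close> is a factor of the column of
      \<open>S'\<close> on the left and of the column of \<open>M\<close> on the right.\<close>
    have "outer_prod (col M' r) (col S' r) = outer_prod (col M (\<sigma> r)) (col S (\<sigma> r))" if r: "r < R" for r
      using M M' S S' r s(1)[OF r]
      by (intro eq_matI) (auto simp: outer_prod_def \<sigma>_def S'_index M_index)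
    with perm show "\<exists>\<sigma>. \<sigma> permutes {..<R} \<and>
        (\<forall>r<R. outer_prod (col M' r) (col S' r) = outer_prod (col M (\<sigma> r)) (col S (\<sigma> r)))" by blast
  qed
qed

text \<open>The type class contains both \<open>real\<close> and \<open>complex\<close>, so that one
  proof serves both fields.\<close>

lemma AE_uniquely_recovered:
  fixes M :: "'a::{real_normed_field,euclidean_space} Matrix.mat"
  assumes "0 < F" "R + ((\<Sum>f<F. d f) + 2 * F) \<le> N" "M \<in> carrier_mat K R" "vec_space.rank K M = R"
  shows "AE \<zeta> in param_measure R F d. uniquely_recovered K N R F d M (source_mat N R F d \<zeta>)"
proof -
  have "R + card (coords F d) \<le> N" using assms(2) by (simp add: card_coords)
  from AE_pole_matching[OF this] show ?thesis
    by eventually_elim (simp add: unique_recovery[OF assms(1,3,4)])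
qed

theorem theorem5:
  fixes K N R F :: nat and d :: "nat \<Rightarrow> nat"
  assumes "0 < K" and "0 < N" and "0 < R" and "0 < F"
    and "int R \<le> int N - int ((\<Sum>f<F. d f) + 2 * F)"
  shows
    "(\<forall>M :: real Matrix.mat. M \<in> carrier_mat K R \<longrightarrow> vec_space.rank K M = R \<longrightarrow>
        (AE \<zeta> in param_measure R F d. uniquely_recovered K N R F d M (source_mat N R F d \<zeta>))) \<and>
     (\<forall>M :: complex Matrix.mat. M \<in> carrier_mat K R \<longrightarrow> vec_space.rank K M = R \<longrightarrow>
        (AE \<zeta> in param_measure R F d. uniquely_recovered K N R F d M (source_mat N R F d \<zeta>)))"
proof -
  have "R + ((\<Sum>f<F. d f) + 2 * F) \<le> N" using assms(5) by linarith
  then show ?thesis by (intro conjI allI impI AE_uniquely_recovered assms(4))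
qed

end
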